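(* Let $k\ge 1$. If $k$ is odd, the number of non-zero integral friezes of Dynkin type $A_k$ is twice the number of positive friezes of type $A_k$. If $k$ is even, the number of non-zero integral friezes of type $A_k$ equals the number of positive friezes of type $A_k$.
   Context: The cluster algebra of Dynkin type $A_k$ is the coefficient-free cluster algebra (a subring, generated over $\mathbb{Z}$ by all cluster variables, of the field of rational functions in the initial variables) whose initial seed has as quiver an orientation of the Dynkin diagram $A_k$. A non-zero integral frieze of this type is a ring homomorphism from the cluster algebra to $\mathbb{Z}$ sending every cluster variable to a non-zero integer; equivalently, an assignment of a non-zero integer to each cluster variable such that all mutation (exchange) relations hold. A positive frieze is such a homomorphism sending every cluster variable to a positive integer. Equivalently, in combinatorial terms: with $n=k+3$, a non-zero integral (resp. positive) frieze of type $A_{k}$ is a labeling of all sides and diagonals of a convex $n$-gon by non-zero (resp. positive) integers, with all sides labeled $1$, such that for every four vertices of the polygon the Ptolemy relation holds: the product of the labels of the two diagonals of the quadrilateral equals the sum of the two products of labels of opposite sides. *)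

theory Defs
  imports
    "HOL-Library.Poly_Mapping"
    "HOL-Library.FuncSet"
    "HOL-Computational_Algebra.Fraction_Field"
begin

text \<open>
  \<^typ>\<open>(nat \<Rightarrow>\<^sub>0 nat) \<Rightarrow>\<^sub>0 int\<close> is the ring of integer polynomials in the variables
  \<open>X\<^sub>0, X\<^sub>1, \<dots>\<close> (finitely supported maps from exponent vectors to coefficients), an integral domain.
  Its fraction field contains the field of rational functions \<open>\<rat>(X\<^sub>0, \<dots>, X\<^bsub>k-1\<^esub>)\<close> for every \<open>k\<close>.
  A cluster algebra of rank \<open>k\<close> only involves \<open>X\<^sub>0, \<dots>, X\<^bsub>k-1\<^esub>\<close>.
\<close>

type_synonym rat_fun = "((nat \<Rightarrow>\<^sub>0 nat) \<Rightarrow>\<^sub>0 int) fract"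

definition initial_variable :: "nat \<Rightarrow> rat_fun" where
  "initial_variable i = Fract (Poly_Mapping.single (Poly_Mapping.single i 1) 1) 1"

text \<open>
  A quiver on the vertices \<open>0, \<dots>, k-1\<close> without loops and 2-cycles is encoded by its signed adjacency
  matrix \<open>B\<close>: \<open>B i j\<close> is the number of arrows \<open>i \<rightarrow> j\<close> minus the number of arrows \<open>j \<rightarrow> i\<close>.
  A labeled seed of rank \<open>k\<close> consists of such a matrix and a cluster \<open>x 0, \<dots>, x (k-1)\<close>. Values of
  \<open>B\<close> and \<open>x\<close> at indices outside \<open>{..<k}\<close> carry no meaning and are never used.
\<close>

type_synonym quiver = "nat \<Rightarrow> nat \<Rightarrow> int"
type_synonym seed = "quiver \<times> (nat \<Rightarrow> rat_fun)"

definition orientation_of_A :: "nat \<Rightarrow> quiver \<Rightarrow> bool" where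
  "orientation_of_A k B \<longleftrightarrow>
     (\<forall>i<k. \<forall>j<k. B j i = - B i j \<and> \<bar>B i j\<bar> = (if j = Suc i \<or> i = Suc j then 1 else 0))"

text \<open>
  Each path \<open>i \<rightarrow> m \<rightarrow> j\<close> contributes an arrow \<open>i \<rightarrow> j\<close>, 2-cycles cancel, and the arrows at \<open>m\<close>
  are reversed.
\<close>

definition mutate_quiver :: "nat \<Rightarrow> quiver \<Rightarrow> quiver" where
  "mutate_quiver m B = (\<lambda>i j.
     if i = m \<or> j = m then - B i j
     else B i j + max 0 (B i m) * max 0 (B m j) - max 0 (- B i m) * max 0 (- B m j))"

text \<open>
  Since \<^const>\<open>nat\<close> sends negative integers to \<open>0\<close>, the two monomials range over the arrows into
  \<open>m\<close> and out of \<open>m\<close>, respectively.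
\<close>

definition mutate_cluster :: "nat \<Rightarrow> nat \<Rightarrow> quiver \<Rightarrow> (nat \<Rightarrow> rat_fun) \<Rightarrow> nat \<Rightarrow> rat_fun" where
  "mutate_cluster k m B x =
     x(m := ((\<Prod>i<k. x i ^ nat (B i m)) + (\<Prod>i<k. x i ^ nat (- B i m))) / x m)"

inductive_set seeds :: "nat \<Rightarrow> quiver \<Rightarrow> seed set" for k :: nat and B\<^sub>0 :: quiver where
  initial: "(B\<^sub>0, initial_variable) \<in> seeds k B\<^sub>0"
| mutation: "(B, x) \<in> seeds k B\<^sub>0 \<Longrightarrow> m < k \<Longrightarrow>
    (mutate_quiver m B, mutate_cluster k m B x) \<in> seeds k B\<^sub>0"

definition cluster_variables :: "nat \<Rightarrow> quiver \<Rightarrow> rat_fun set" where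
  "cluster_variables k B\<^sub>0 = {x i | B x i. (B, x) \<in> seeds k B\<^sub>0 \<and> i < k}"

inductive_set generated_subring :: "'a::comm_ring_1 set \<Rightarrow> 'a set" for S :: "'a set" where
  gen: "a \<in> S \<Longrightarrow> a \<in> generated_subring S"
| one: "1 \<in> generated_subring S"
| uminus: "a \<in> generated_subring S \<Longrightarrow> - a \<in> generated_subring S"
| add: "a \<in> generated_subring S \<Longrightarrow> b \<in> generated_subring S \<Longrightarrow> a + b \<in> generated_subring S"
| mult: "a \<in> generated_subring S \<Longrightarrow> b \<in> generated_subring S \<Longrightarrow> a * b \<in> generated_subring S"

definition cluster_algebra :: "nat \<Rightarrow> quiver \<Rightarrow> rat_fun set" where
  "cluster_algebra k B\<^sub>0 = generated_subring (cluster_variables k B\<^sub>0)"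

text \<open>
  Unital ring homomorphisms from a subring \<open>R\<close>. Restricting to \<^const>\<open>extensional\<close> functions fixes
  the values outside \<open>R\<close>, so that each homomorphism on \<open>R\<close> is represented by exactly one function
  and can be counted.
\<close>

definition ring_homs :: "'a::comm_ring_1 set \<Rightarrow> ('a \<Rightarrow> 'b::comm_ring_1) set" where
  "ring_homs R = {f \<in> extensional R. f 1 = 1 \<and>
     (\<forall>a\<in>R. \<forall>b\<in>R. f (a + b) = f a + f b \<and> f (a * b) = f a * f b)}"

definition nonzero_friezes :: "nat \<Rightarrow> quiver \<Rightarrow> (rat_fun \<Rightarrow> int) set" where
  "nonzero_friezes k B\<^sub>0 =
     {f \<in> ring_homs (cluster_algebra k B\<^sub>0). \<forall>x\<in>cluster_variables k B\<^sub>0. f x \<noteq> 0}"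

definition positive_friezes :: "nat \<Rightarrow> quiver \<Rightarrow> (rat_fun \<Rightarrow> int) set" where
  "positive_friezes k B\<^sub>0 =
     {f \<in> ring_homs (cluster_algebra k B\<^sub>0). \<forall>x\<in>cluster_variables k B\<^sub>0. f x > 0}"

end

theory Submission
  imports Defs
begin

text \<open>
  Let \<open>f\<close> be a non-zero frieze. Any orientation of the path is carried to the linear one by mutations at
  sinks and sources, and sweeping over the linear orientation again and again turns the exchange
  relations into Coxeter's unimodular rule (\<open>linear_seed_frieze_pattern\<close>). So the values of \<open>f\<close> form a
  frieze pattern with non-zero integer entries, and this one is realized by the determinants of
  \<open>k + 3\<close> points of the plane, that is, by a polygon with non-zero integer labels satisfying the
  Ptolemy relations (\<open>frieze_pattern_bracket\<close>).

  For such polygons the argument is an induction on the number of vertices. If every short diagonal had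
  absolute value at least \<open>2\<close>, the labels seen from a fixed vertex would grow and never come back to
  \<open>1\<close>; hence there is an ear that can be cut off (\<open>ear_exists\<close>). Gluing the ear back at most doubles the
  labels (\<open>unit_polygon_bound\<close>), and the absence of zeros forces the signs to be those of a positive
  labeling, up to changing the signs of the points and one global sign (\<open>unit_polygon_signs\<close>). As the
  sides are labeled \<open>1\<close>, only two possibilities remain: all labels are positive, or \<open>k\<close> is odd and
  the signs alternate along a row (\<open>frieze_pattern_row_sign\<close>).

  On the algebraic side, the exchange relations show that \<open>f\<close> is determined by its values on any one
  seed (\<open>frieze_eqI\<close>), which together with the bound gives finiteness, and that \<open>f\<close> is positive as soon
  as it is positive on one seed (\<open>positive_frieze_iff\<close>). Hence every non-zero frieze is positive for
  even \<open>k\<close>. For odd \<open>k\<close>, changing the signs of the initial variables with even index extends to an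
  involution of the cluster algebra that maps each cluster variable to itself or its negative, because
  these signs come from a grading of the seeds modulo \<open>2\<close> (\<open>seeds_graded\<close>). Composition with
  it exchanges the positive friezes with those having alternating signs.
\<close>

section \<open>Polygons with unit sides\<close>

text \<open>
  The vertices \<open>p\<close> of a polygon are placed at the points \<open>(u p, w p)\<close> of the plane, and a side or diagonal
  is labeled by the determinant of its two end points. This makes the Ptolemy relation an identity,
  valid for all quadruples of vertices, and labels every set of vertices at once, so that removing a
  vertex needs no new labeling.
\<close>

definition bracket :: "('a \<Rightarrow> int) \<Rightarrow> ('a \<Rightarrow> int) \<Rightarrow> 'a \<Rightarrow> 'a \<Rightarrow> int" where
  "bracket u w p q = u p * w q - u q * w p"

lemma bracket_self [simp]: "bracket u w p p = 0"
  by (simp add: bracket_def)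

lemma bracket_swap: "bracket u w q p = - bracket u w p q"
  by (simp add: bracket_def)

lemma abs_bracket_swap: "\<bar>bracket u w q p\<bar> = \<bar>bracket u w p q\<bar>"
  by (simp add: bracket_def)

lemma ptolemy:
  "bracket u w p r * bracket u w q s =
     bracket u w p q * bracket u w r s + bracket u w p s * bracket u w q r"
  by (simp add: bracket_def algebra_simps)

text \<open>
  Labels are considered up to sign on the sides because removing a vertex \<open>j\<close> whose neighbours are joined
  by a diagonal labeled \<open>-1\<close> turns that diagonal into a side. The class is then closed under cutting ears.
\<close>

definition unit_polygon :: "('a \<Rightarrow> int) \<Rightarrow> ('a \<Rightarrow> int) \<Rightarrow> 'a list \<Rightarrow> bool" where
  "unit_polygon u w ps \<longleftrightarrow>
     sorted_wrt (\<lambda>p q. bracket u w p q \<noteq> 0) ps \<and>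
     successively (\<lambda>p q. \<bar>bracket u w p q\<bar> = 1) ps \<and>
     \<bar>bracket u w (hd ps) (last ps)\<bar> = 1"

lemma unit_polygon_distinct: "unit_polygon u w ps \<Longrightarrow> distinct ps"
  unfolding unit_polygon_def distinct_conv_nth sorted_wrt_iff_nth_less
  by (metis bracket_self linorder_neqE_nat)

text \<open>
  By the Ptolemy relation, \<open>\<bar>b d\<bar> \<cdot> \<bar>a j\<bar> \<le> \<bar>a b\<bar> + \<bar>a d\<bar>\<close> for consecutive vertices \<open>b, j, d\<close>. So if no short
  diagonal \<open>b d\<close> has absolute value below \<open>2\<close>, the absolute labels seen from \<open>a\<close> form a convex
  sequence, and once they increase they go on increasing.
\<close>

lemma growth:
  assumes "successively (\<lambda>p q. \<bar>bracket u w p q\<bar> = 1) (b # j # rest)"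
    and "\<And>as b' j' d' bs. b # j # rest = as @ b' # j' # d' # bs \<Longrightarrow> \<bar>bracket u w b' d'\<bar> \<ge> 2"
    and "\<bar>bracket u w a b\<bar> < \<bar>bracket u w a j\<bar>"
  shows "\<bar>bracket u w a b\<bar> < \<bar>bracket u w a (last (j # rest))\<bar>"
  using assms
proof (induction rest arbitrary: b j)
  case Nil
  then show ?case by simp
next
  case (Cons d rest)
  have two: "\<bar>bracket u w b d\<bar> \<ge> 2"
    using Cons.prems(2)[of "[]" b j d rest] by simp
  have unit: "\<bar>bracket u w b j\<bar> = 1" "\<bar>bracket u w j d\<bar> = 1"
    using Cons.prems(1) by auto
  have "bracket u w b d * bracket u w a j = bracket u w a b * bracket u w j d + bracket u w a d * bracket u w b j"
    by (simp add: bracket_def algebra_simps)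
  then have "\<bar>bracket u w b d\<bar> * \<bar>bracket u w a j\<bar> \<le> \<bar>bracket u w a b\<bar> + \<bar>bracket u w a d\<bar>"
    using abs_triangle_ineq[of "bracket u w a b * bracket u w j d" "bracket u w a d * bracket u w b j"]
    by (simp add: abs_mult unit flip: abs_mult[of "bracket u w b d"])
  moreover have "2 * \<bar>bracket u w a j\<bar> \<le> \<bar>bracket u w b d\<bar> * \<bar>bracket u w a j\<bar>"
    using two by (intro mult_right_mono) auto
  ultimately have "\<bar>bracket u w a j\<bar> < \<bar>bracket u w a d\<bar>"
    using Cons.prems(3) by linarith
  moreover have "\<bar>bracket u w b' d'\<bar> \<ge> 2"
    if "j # d # rest = as @ b' # j' # d' # bs" for as b' j' d' bs
    using Cons.prems(2)[of "b # as" b' j' d' bs] that by simp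
  moreover have "successively (\<lambda>p q. \<bar>bracket u w p q\<bar> = 1) (j # d # rest)"
    using Cons.prems(1) by simp
  ultimately have "\<bar>bracket u w a j\<bar> < \<bar>bracket u w a (last (d # rest))\<bar>"
    by (intro Cons.IH)
  then show ?case using Cons.prems(3) by simp
qed

text \<open>
  Seen from the first vertex, the labels start with \<open>0\<close> and \<open>1\<close> and end with \<open>1\<close> in absolute value,
  which contradicts growth unless some short diagonal is \<open>1\<close> in absolute value. The vertex cut off lies
  strictly between the two ends of the list, so the side closing the polygon survives the cut.
\<close>

lemma ear_exists:
  assumes "unit_polygon u w ps" and "length ps \<ge> 3"
  obtains as b j d bs where "ps = as @ b # j # d # bs" and "\<bar>bracket u w b d\<bar> = 1"
proof (rule ccontr)
  assume no: "\<not> thesis"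
  note witness = that
  have nz: "sorted_wrt (\<lambda>p q. bracket u w p q \<noteq> 0) ps"
    and un: "successively (\<lambda>p q. \<bar>bracket u w p q\<bar> = 1) ps"
    and cl: "\<bar>bracket u w (hd ps) (last ps)\<bar> = 1"
    using assms(1) by (auto simp: unit_polygon_def)
  have two: "\<bar>bracket u w b d\<bar> \<ge> 2" if "ps = as @ b # j # d # bs" for as b j d bs
  proof -
    have "bracket u w b d \<noteq> 0" using nz unfolding that by (simp add: sorted_wrt_append)
    moreover have "\<bar>bracket u w b d\<bar> \<noteq> 1" using no witness that by blast
    ultimately show ?thesis by linarith
  qed
  obtain a b c rest where ps: "ps = a # b # c # rest"
    using assms(2) by (auto simp: numeral_3_eq_3 Suc_le_length_iff)
  have "\<bar>bracket u w a b\<bar> = 1" using un ps by simp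
  moreover have "\<bar>bracket u w a c\<bar> \<ge> 2" using two[of "[]" a b c rest] ps by simp
  ultimately have "\<bar>bracket u w a b\<bar> < \<bar>bracket u w a (last (c # rest))\<bar>"
    using un two[of "a # _"] unfolding ps by (intro growth) auto
  then show False using cl \<open>\<bar>bracket u w a b\<bar> = 1\<close> unfolding ps by simp
qed

lemma unit_polygon_cut_ear:
  assumes "unit_polygon u w (as @ b # j # d # bs)" and "\<bar>bracket u w b d\<bar> = 1"
  shows "unit_polygon u w (as @ b # d # bs)"
proof -
  have "hd (as @ b # d # bs) = hd (as @ b # j # d # bs)" by (cases as) auto
  moreover have "last (as @ b # d # bs) = last (as @ b # j # d # bs)" by simp
  ultimately show ?thesis
    using assms unfolding unit_polygon_def
    by (auto simp only: sorted_wrt_append successively_append_iff sorted_wrt.simps successively.simps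
        set_append list.set Un_iff ball_Un list.sel hd_append list.distinct)
qed

lemma unit_polygon_ear_sides:
  assumes "unit_polygon u w (as @ b # j # d # bs)"
  shows "\<bar>bracket u w b j\<bar> = 1" and "\<bar>bracket u w j d\<bar> = 1"
  using assms unfolding unit_polygon_def by (auto simp: successively_append_iff)

text \<open>
  This stands for the fact that the diagonals labeled \<open>\<plusminus>1\<close> contain a triangulation, and \<open>p, q, r\<close> is the
  triangle lying on the side \<open>p q\<close>. Either the ear provided by the previous lemma is that triangle, or
  \<open>p q\<close> is still a side after that ear has been cut off.
\<close>

lemma triangle_on_edge:
  assumes "unit_polygon u w ps" and "length ps \<ge> 3" and "ps = xs @ p # q # ys"
  shows "\<exists>r\<in>set ps. \<bar>bracket u w p r\<bar> = 1 \<and> \<bar>bracket u w q r\<bar> = 1"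
  using assms
proof (induction "length ps" arbitrary: ps xs p q ys rule: less_induct)
  case less
  obtain as b j d bs where ps: "ps = as @ b # j # d # bs" and ear: "\<bar>bracket u w b d\<bar> = 1"
    using ear_exists[OF less.prems(1,2)] by blast
  note sides = unit_polygon_ear_sides[OF less.prems(1)[unfolded ps]]
  have dist: "distinct ps" using less.prems(1) by (rule unit_polygon_distinct)
  consider (left) "q = j" | (right) "p = j" | (other) "p \<noteq> j" "q \<noteq> j" by blast
  then show ?case
  proof cases
    case left
    then have "(as @ [b]) @ j # (d # bs) = (xs @ [p]) @ j # ys"
      using ps less.prems(3) by simp
    then have "as @ [b] = xs @ [p]"
      using dist less.prems(3) left by (subst (asm) append_Cons_eq_iff) (auto simp: ps)
    then show ?thesis
      using left ear sides by (intro bexI[of _ d]) (auto simp: ps)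
  next
    case right
    then have "(as @ [b]) @ j # (d # bs) = xs @ j # (q # ys)"
      using ps less.prems(3) by simp
    then have "d # bs = q # ys"
      using dist less.prems(3) right by (subst (asm) append_Cons_eq_iff) (auto simp: ps)
    then show ?thesis
      using right ear sides by (intro bexI[of _ b]) (auto simp: ps abs_bracket_swap)
  next
    case other
    let ?ps' = "as @ b # d # bs"
    have "?ps' = filter (\<lambda>r. r \<noteq> j) ps"
    proof -
      have "filter (\<lambda>r. r \<noteq> j) as = as" "filter (\<lambda>r. r \<noteq> j) bs = bs"
        by (rule filter_True, use dist ps in auto)+
      then show ?thesis using dist by (auto simp: ps)
    qed
    then have cut: "?ps' = filter (\<lambda>r. r \<noteq> j) xs @ p # q # filter (\<lambda>r. r \<noteq> j) ys"
      using less.prems(3) other by simp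
    have "length ?ps' \<ge> 3"
    proof (rule ccontr)
      assume "\<not> length ?ps' \<ge> 3"
      then have "as = []" "bs = []" by (cases as; cases bs; simp)+
      then show False using ps less.prems(3) other
        by (auto simp: Cons_eq_append_conv append_eq_Cons_conv)
    qed
    then have "\<exists>r\<in>set ?ps'. \<bar>bracket u w p r\<bar> = 1 \<and> \<bar>bracket u w q r\<bar> = 1"
      using less.hyps[OF _ unit_polygon_cut_ear[OF less.prems(1)[unfolded ps] ear] _ cut]
      by (auto simp: ps)
    then show ?thesis by (auto simp: ps)
  qed
qed

lemma bracket_ear:
  assumes "\<bar>bracket u w b d\<bar> = 1" "\<bar>bracket u w b j\<bar> = 1" "\<bar>bracket u w j d\<bar> = 1"
  shows "\<bar>bracket u w j q\<bar> \<le> \<bar>bracket u w b q\<bar> + \<bar>bracket u w d q\<bar>"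
proof -
  have "bracket u w b d * bracket u w j q = bracket u w b j * bracket u w d q + bracket u w b q * bracket u w j d"
    by (rule ptolemy)
  then have "\<bar>bracket u w b d\<bar> * \<bar>bracket u w j q\<bar> \<le>
      \<bar>bracket u w b j\<bar> * \<bar>bracket u w d q\<bar> + \<bar>bracket u w b q\<bar> * \<bar>bracket u w j d\<bar>"
    by (metis abs_mult abs_triangle_ineq)
  then show ?thesis by (simp add: assms)
qed

text \<open>
  Gluing an ear to a polygon at most doubles the largest absolute label.
\<close>

lemma unit_polygon_bound:
  assumes "unit_polygon u w ps" and "length ps \<ge> 2" and "p \<in> set ps" and "q \<in> set ps"
  shows "\<bar>bracket u w p q\<bar> \<le> 2 ^ length ps"
  using assms
proof (induction "length ps" arbitrary: ps p q rule: less_induct)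
  case less
  show ?case
  proof (cases "length ps \<ge> 3")
    case False
    then obtain a b where "ps = [a, b]"
    proof -
      have "length ps = Suc (Suc 0)" using False less.prems(2) by linarith
      then show ?thesis using that by (auto simp: length_Suc_conv)
    qed
    then show ?thesis
      using less.prems by (auto simp: unit_polygon_def abs_bracket_swap)
  next
    case True
    obtain as b j d bs where ps: "ps = as @ b # j # d # bs" and ear: "\<bar>bracket u w b d\<bar> = 1"
      using ear_exists[OF less.prems(1) True] by blast
    note sides = unit_polygon_ear_sides[OF less.prems(1)[unfolded ps]]
    let ?N = "length as + length bs + 2"
    have old: "\<bar>bracket u w p q\<bar> \<le> 2 ^ ?N"
      if "p \<in> set (as @ b # d # bs)" "q \<in> set (as @ b # d # bs)" for p q
      using less.hyps[OF _ unit_polygon_cut_ear[OF less.prems(1)[unfolded ps] ear] _ that]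
      by (auto simp: ps)
    have len: "(2::int) ^ length ps = 2 * 2 ^ ?N" by (simp add: ps)
    have new: "\<bar>bracket u w j q\<bar> \<le> 2 ^ length ps" if "q \<in> set ps" for q
    proof (cases "q = j")
      case False
      then have "q \<in> set (as @ b # d # bs)" using that ps by auto
      then show ?thesis
        using bracket_ear[OF ear sides, of q] old[of b q] old[of d q] len by auto
    qed simp
    show ?thesis
    proof (cases "p = j \<or> q = j")
      case True
      then show ?thesis using new less.prems(3,4) abs_bracket_swap by metis
    next
      case False
      then have "\<bar>bracket u w p q\<bar> \<le> 2 ^ ?N" using less.prems(3,4) by (intro old) (auto simp: ps)
      also have "\<dots> \<le> 2 ^ length ps" using len by simp
      finally show ?thesis .
    qed
  qed
qed

lemma int_sign_cases: "\<bar>z::int\<bar> = 1 \<longleftrightarrow> z = 1 \<or> z = -1"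
  by auto

text \<open>
  Changing the sign of the point at a vertex, or of all labels, preserves the Ptolemy relations; up to
  these changes every label is positive. By induction this is achieved for the polygon without an ear
  \<open>j\<close> between \<open>b\<close> and \<open>d\<close>, and the sign at \<open>j\<close> can be chosen so that \<open>b j\<close> becomes \<open>1\<close>. If \<open>j d\<close> becomes
  \<open>1\<close> too, each label at \<open>j\<close> is a sum of two positive ones. If it becomes \<open>-1\<close>, each label at \<open>j\<close> is the
  difference of those at \<open>b\<close> and \<open>d\<close>; it vanishes at the apex of the triangle on \<open>b d\<close>, which is
  excluded. A triangle is the base case: there the product of its three labels determines the global
  sign \<open>\<epsilon>\<close>.
\<close>

lemma unit_polygon_signs:
  assumes "unit_polygon u w ps" and "length ps \<ge> 3"
  shows "\<exists>\<epsilon> s. \<bar>\<epsilon>\<bar> = 1 \<and> (\<forall>p. \<bar>s p\<bar> = 1) \<and>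
    sorted_wrt (\<lambda>p q. \<epsilon> * s p * s q * bracket u w p q > 0) ps"
  using assms
proof (induction "length ps" arbitrary: ps rule: less_induct)
  case less
  have dist: "distinct ps" using less.prems(1) by (rule unit_polygon_distinct)
  show ?case
  proof (cases "length ps = 3")
    case True
    then obtain a b c where ps: "ps = [a, b, c]"
      by (auto simp: numeral_3_eq_3 length_Suc_conv)
    let ?e = "bracket u w a b * bracket u w b c * bracket u w a c"
    let ?s = "\<lambda>p. if p = b then ?e * bracket u w a b else if p = c then ?e * bracket u w a c else 1"
    have "\<bar>bracket u w a b\<bar> = 1" "\<bar>bracket u w b c\<bar> = 1" "\<bar>bracket u w a c\<bar> = 1"
      using less.prems(1) by (auto simp: ps unit_polygon_def)
    then show ?thesis
      using dist by (intro exI[of _ ?e] exI[of _ ?s]) (auto simp: ps int_sign_cases)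
  next
    case False
    obtain as b j d bs where ps: "ps = as @ b # j # d # bs" and ear: "\<bar>bracket u w b d\<bar> = 1"
      using ear_exists[OF less.prems] by blast
    note sides = unit_polygon_ear_sides[OF less.prems(1)[unfolded ps]]
    note cut = unit_polygon_cut_ear[OF less.prems(1)[unfolded ps] ear]
    have len: "length (as @ b # d # bs) \<ge> 3" using False less.prems(2) unfolding ps length_append list.size by linarith
    obtain \<epsilon> s where e: "\<bar>\<epsilon>\<bar> = 1" and s: "\<And>p. \<bar>s p\<bar> = 1"
      and old: "sorted_wrt (\<lambda>p q. \<epsilon> * s p * s q * bracket u w p q > 0) (as @ b # d # bs)"
      using less.hyps[OF _ cut len] by (auto simp: ps)
    define s' where "s' = s(j := \<epsilon> * s b * bracket u w b j)"
    define y where "y p q = \<epsilon> * s' p * s' q * bracket u w p q" for p q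
    have s': "\<bar>s' p\<bar> = 1" for p
      using e s sides by (auto simp: s'_def abs_mult)
    have y_abs: "\<bar>y p q\<bar> = \<bar>bracket u w p q\<bar>" for p q
      using e s' by (simp add: y_def abs_mult)
    have y_ptolemy: "y p r * y q t = y p q * y r t + y p t * y q r" for p q r t
    proof -
      let ?k = "\<epsilon> * \<epsilon> * s' p * s' q * s' r * s' t"
      have "y p r * y q t = ?k * (bracket u w p r * bracket u w q t)"
        by (simp add: y_def algebra_simps)
      also have "\<dots> = ?k * (bracket u w p q * bracket u w r t + bracket u w p t * bracket u w q r)"
        by (simp only: ptolemy[of u w p r q t])
      also have "\<dots> = y p q * y r t + y p t * y q r"
        by (simp add: y_def algebra_simps)
      finally show ?thesis .
    qed
    have "j \<notin> set (as @ b # d # bs)" using dist by (auto simp: ps)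
    then have "sorted_wrt (\<lambda>p q. y p q > 0) (as @ b # d # bs)"
      using old by (intro sorted_wrt_mono_rel[OF _ old]) (auto simp: y_def s'_def)
    then have y_old: "sorted_wrt (\<lambda>p q. y p q > 0) as" "sorted_wrt (\<lambda>p q. y p q > 0) bs"
      "y b d > 0" "\<And>p. p \<in> set as \<Longrightarrow> y p b > 0 \<and> y p d > 0"
      "\<And>q. q \<in> set bs \<Longrightarrow> y b q > 0 \<and> y d q > 0"
      "\<And>p q. p \<in> set as \<Longrightarrow> q \<in> set bs \<Longrightarrow> y p q > 0"
      by (auto simp: sorted_wrt_append)
    have y_bd: "y b d = 1" using y_old(3) ear y_abs[of b d] by simp
    have "b \<noteq> j" using dist by (auto simp: ps)
    have y_bj: "y b j = 1"
    proof -
      have "y b j = (\<epsilon> * \<epsilon>) * (s b * s b) * (bracket u w b j * bracket u w b j)"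
        using \<open>b \<noteq> j\<close> by (simp add: y_def s'_def algebra_simps)
      also have "\<dots> = 1"
        using e s[of b] sides(1) by (metis abs_mult_self_eq mult.right_neutral)
      finally show ?thesis .
    qed
    have y_swap: "y q p = - y p q" for p q
      by (simp add: y_def bracket_swap[of u w q p])
    have "y j d = 1"
    proof (rule ccontr)
      assume "y j d \<noteq> 1"
      moreover have "\<bar>y j d\<bar> = 1" using sides y_abs by simp
      ultimately have jd: "y j d = -1" by linarith
      obtain r where r: "r \<in> set (as @ b # d # bs)" "\<bar>bracket u w b r\<bar> = 1" "\<bar>bracket u w d r\<bar> = 1"
        using triangle_on_edge[OF cut len refl] by blast
      then have "r \<noteq> b" "r \<noteq> d" by auto
      then consider "r \<in> set as" | "r \<in> set bs" using r(1) by auto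
      then have "y b r = y d r"
      proof cases
        case 1
        then show ?thesis using y_old(4)[of r] r y_abs[of b r] y_abs[of d r] y_swap[of r b] y_swap[of r d]
          by linarith
      next
        case 2
        then show ?thesis using y_old(5)[of r] r y_abs[of b r] y_abs[of d r] by linarith
      qed
      then have "y j r = 0"
        using y_ptolemy[of b d j r] y_bd y_bj jd by simp
      then have "bracket u w j r = 0" using y_abs[of j r] by simp
      moreover have "bracket u w j r \<noteq> 0"
        using less.prems(1) r(1) \<open>r \<noteq> b\<close> \<open>r \<noteq> d\<close> bracket_swap[of u w j r]
        by (auto simp: ps unit_polygon_def sorted_wrt_append)
      ultimately show False by simp
    qed
    moreover have "y p j > 0" if "p \<in> set as" for p
      using y_ptolemy[of p j b d] y_old(4)[OF that] y_bd y_bj calculation by simp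
    moreover have "y j q > 0" if "q \<in> set bs" for q
      using y_ptolemy[of b d j q] y_old(5)[OF that] y_bd y_bj calculation(1) by simp
    ultimately have "sorted_wrt (\<lambda>p q. y p q > 0) ps"
      using y_old y_bj by (auto simp: ps sorted_wrt_append)
    then show ?thesis using e s' unfolding y_def by blast
  qed
qed

section \<open>Frieze patterns\<close>

text \<open>
  This is Coxeter's unimodular rule, where \<open>y t d\<close> is the label of the diagonal from vertex \<open>t\<close> to vertex
  \<open>t + d\<close>. A row begins with the border \<open>0, 1\<close> and ends with the border \<open>1\<close> at \<open>d = k + 2\<close>. The
  entries with \<open>t + d \<le> k + 2\<close> label one polygon with vertices \<open>0, \<dots>, k + 2\<close>.
\<close>

definition frieze_pattern :: "nat \<Rightarrow> (nat \<Rightarrow> nat \<Rightarrow> int) \<Rightarrow> bool" where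
  "frieze_pattern k y \<longleftrightarrow>
     (\<forall>t. y t 0 = 0 \<and> y t 1 = 1 \<and> y t (k + 2) = 1) \<and>
     (\<forall>t d. 1 \<le> d \<longrightarrow> d \<le> k + 1 \<longrightarrow> y t d \<noteq> 0 \<and>
        y (Suc t) d * y t d = 1 + y (Suc t) (d - 1) * y t (d + 1))"

lemma frieze_patternD:
  assumes "frieze_pattern k y"
  shows "y t 0 = 0" and "y t (Suc 0) = 1" and "y t (k + 2) = 1"
    and "1 \<le> d \<Longrightarrow> d \<le> k + 1 \<Longrightarrow> y t d \<noteq> 0"
    and "1 \<le> d \<Longrightarrow> d \<le> k + 1 \<Longrightarrow>
      y (Suc t) d * y t d = 1 + y (Suc t) (d - 1) * y t (d + 1)"
  using assms unfolding frieze_pattern_def One_nat_def by blast+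

text \<open>
  Subtracting two neighbouring unimodular rules shows that
  \<open>(y t (d + 1) + y t (d - 1)) / y t d\<close> is constant along each diagonal \<open>t + d = q\<close>; its value is read off
  at \<open>d = 1\<close>.
\<close>

lemma frieze_pattern_recurrence:
  assumes "frieze_pattern k y" and "1 \<le> d" and "d \<le> k + 1"
  shows "y t (d + 1) = y (t + d - 1) 2 * y t d - y t (d - 1)"
  using assms(2,3)
proof (induction d arbitrary: t rule: dec_induct)
  case base
  then show ?case using frieze_patternD(1,2)[OF assms(1), of t] by (simp add: numeral_2_eq_2)
next
  case (step d)
  let ?c = "y (t + d) 2"
  have d: "1 \<le> d" "d \<le> k + 1" "d + 1 \<le> k + 1" using step by auto
  have IH: "y (Suc t) (d + 1) + y (Suc t) (d - 1) = ?c * y (Suc t) d"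
    using step.IH[of "Suc t"] d by simp
  have "y (Suc t) d * y t d = 1 + y (Suc t) (d - 1) * y t (d + 1)"
    and "y (Suc t) (d + 1) * y t (d + 1) = 1 + y (Suc t) d * y t (d + 2)"
    and nz: "y (Suc t) d \<noteq> 0"
    using frieze_patternD(4)[OF assms(1) d(1,2)] frieze_patternD(5)[OF assms(1) d(1,2)]
      frieze_patternD(5)[OF assms(1) _ d(3), of t] by auto
  then have "y (Suc t) d * (y t (d + 2) + y t d) =
      y t (d + 1) * (y (Suc t) (d + 1) + y (Suc t) (d - 1))"
    by (simp add: algebra_simps)
  also have "\<dots> = y (Suc t) d * (?c * y t (d + 1))"
    unfolding IH by (simp add: algebra_simps)
  finally have "y t (d + 2) + y t d = ?c * y t (d + 1)" using nz by simp
  then show ?case by (simp add: algebra_simps)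
qed

text \<open>
  Up to sign this is the row \<open>1\<close> of the frieze, written as a function of the end vertex \<open>q = 1 + d\<close> of a
  diagonal; the value at \<open>q = 0\<close> continues the linear recurrence backwards.
\<close>

definition frieze_u :: "(nat \<Rightarrow> nat \<Rightarrow> int) \<Rightarrow> nat \<Rightarrow> int" where
  "frieze_u y q = (if q = 0 then 1 else - y 1 (q - 1))"

lemma frieze_vectors_recurrence:
  assumes "frieze_pattern k y" and "1 \<le> q" and "q \<le> k + 1"
  shows "y 0 (Suc q) = y (q - 1) 2 * y 0 q - y 0 (q - 1)"
    and "frieze_u y (Suc q) = y (q - 1) 2 * frieze_u y q - frieze_u y (q - 1)"
proof -
  show "y 0 (Suc q) = y (q - 1) 2 * y 0 q - y 0 (q - 1)"
    using frieze_pattern_recurrence[OF assms, of 0] by simp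
  show "frieze_u y (Suc q) = y (q - 1) 2 * frieze_u y q - frieze_u y (q - 1)"
  proof (cases "q = 1")
    case True
    then show ?thesis using frieze_patternD(1,2)[OF assms(1)] by (simp add: frieze_u_def)
  next
    case False
    then show ?thesis
      using frieze_pattern_recurrence[OF assms(1), of "q - 1" 1] assms(2,3)
      by (simp add: frieze_u_def)
  qed
qed

text \<open>
  Rows \<open>0\<close> and \<open>1\<close> give points in the plane whose determinants recover the whole frieze: for fixed
  \<open>p\<close> both sides satisfy the same recurrence in \<open>d\<close> and agree at \<open>d = 0\<close> and, since the Wronskian of two
  solutions is constant, at \<open>d = 1\<close>.
\<close>

lemma frieze_pattern_bracket:
  assumes "frieze_pattern k y" and "p + d \<le> k + 2"
  shows "bracket (frieze_u y) (y 0) p (p + d) = y p d"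
proof -
  let ?D = "bracket (frieze_u y) (y 0)"
  have init: "y t 0 = 0" "y t (Suc 0) = 1" for t
    using frieze_patternD(1,2)[OF assms(1)] by auto
  have rec: "?D p (q + 1) = y (q - 1) 2 * ?D p q - ?D p (q - 1)" if "1 \<le> q" "q \<le> k + 1" for p q
    unfolding bracket_def Suc_eq_plus1[symmetric] frieze_vectors_recurrence[OF assms(1) that]
    by (simp add: algebra_simps)
  have wronskian: "?D p (p + 1) = 1" if "p \<le> k + 1" for p
    using that
  proof (induction p)
    case 0
    then show ?case by (simp add: bracket_def frieze_u_def init)
  next
    case (Suc p)
    then have "?D (Suc p) (Suc p + 1) = - ?D (Suc p) p"
      using rec[of "Suc p" "Suc p"] by simp
    then show ?case using Suc by (simp add: bracket_swap[of _ _ "Suc p" p])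
  qed
  show ?thesis
    using assms(2)
  proof (induction d rule: less_induct)
    case (less d)
    have "d = 0 \<or> d = 1 \<or> (\<exists>d'. d = d' + 2)" by presburger
    then consider "d = 0" | "d = 1" | d' where "d = d' + 2" by blast
    then show ?case
    proof cases
      case 1
      then show ?thesis by (simp add: init)
    next
      case 2
      then show ?thesis using wronskian[of p] less.prems init by simp
    next
      case (3 d')
      then have "?D p (p + (d' + 1)) = y p (d' + 1)" "?D p (p + d') = y p d'"
        using less.IH[of "d' + 1"] less.IH[of d'] less.prems by auto
      then show ?thesis
        using rec[of "p + d' + 1" p] frieze_pattern_recurrence[OF assms(1), of "d' + 1" p]
          less.prems 3 by simp
    qed
  qed
qed

lemma frieze_pattern_polygon:
  assumes "frieze_pattern k y"
  shows "unit_polygon (frieze_u y) (y 0) [0..<k + 3]"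
proof -
  let ?D = "bracket (frieze_u y) (y 0)"
  have D: "?D p q = y p (q - p)" if "p \<le> q" "q \<le> k + 2" for p q
    using frieze_pattern_bracket[OF assms, of p "q - p"] that by simp
  have "?D p q \<noteq> 0" if "p < q" "q < k + 3" for p q
  proof -
    have "y p (q - p) \<noteq> 0"
    proof (cases "q - p = k + 2")
      case True
      then show ?thesis using frieze_patternD(3)[OF assms, of p] by simp
    next
      case False
      then show ?thesis using that by (intro frieze_patternD(4)[OF assms]) auto
    qed
    then show ?thesis using D that by simp
  qed
  moreover have "\<bar>?D p (Suc p)\<bar> = 1" if "Suc p < k + 3" for p
    using D[of p "Suc p"] that frieze_patternD(2)[OF assms] by simp
  moreover have "?D 0 (k + 2) = 1"
    using D[of 0 "k + 2"] frieze_patternD(3)[OF assms] by simp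
  ultimately show ?thesis
    by (auto simp: unit_polygon_def sorted_wrt_iff_nth_less successively_conv_nth
        hd_upt last_upt simp del: upt_Suc)
qed

lemma frieze_pattern_row_bound:
  assumes "frieze_pattern k y" and "d \<le> k + 2"
  shows "\<bar>y 0 d\<bar> \<le> 2 ^ (k + 3)"
  using unit_polygon_bound[OF frieze_pattern_polygon[OF assms(1)], of 0 d]
    frieze_pattern_bracket[OF assms(1), of 0 d] assms(2)
  by (simp del: upt_Suc)

text \<open>
  All sides are labeled \<open>1\<close>, so the signs of the vertices satisfy \<open>s (p + 1) = \<epsilon> s p\<close>, and the side from
  \<open>0\<close> to \<open>k + 2\<close> forces \<open>\<epsilon> ^ (k + 3) = 1\<close>. For \<open>\<epsilon> = 1\<close> the frieze is positive; \<open>\<epsilon> = -1\<close> needs odd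
  \<open>k\<close>, and the signs along a row alternate.
\<close>

lemma frieze_pattern_row_sign:
  assumes "frieze_pattern k y"
  shows "(\<forall>d. 1 \<le> d \<longrightarrow> d \<le> k + 1 \<longrightarrow> y 0 d > 0) \<or>
    odd k \<and> (\<forall>d. 1 \<le> d \<longrightarrow> d \<le> k + 1 \<longrightarrow> (-1) ^ (d + 1) * y 0 d > 0)"
proof -
  let ?D = "bracket (frieze_u y) (y 0)"
  obtain \<epsilon> s where e: "\<bar>\<epsilon>\<bar> = 1" and s: "\<And>p. \<bar>s p\<bar> = 1"
    and "sorted_wrt (\<lambda>p q. \<epsilon> * s p * s q * ?D p q > 0) [0..<k + 3]"
    using unit_polygon_signs[OF frieze_pattern_polygon[OF assms]] by auto
  then have pos_D: "\<epsilon> * s p * s (p + d) * ?D p (p + d) > 0" if "1 \<le> d" "p + d \<le> k + 2" for p d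
    using sorted_wrt_nth_less[of _ "[0..<k + 3]" p "p + d"] that by (simp del: upt_Suc)
  have pos: "\<epsilon> * s p * s (p + d) * y p d > 0" if "1 \<le> d" "p + d \<le> k + 2" for p d
    using pos_D[OF that] unfolding frieze_pattern_bracket[OF assms that(2)] .
  have pm: "z = 1 \<or> z = -1" if "\<bar>z\<bar> = 1" for z :: int using that by linarith
  have step: "s (Suc p) = \<epsilon> * s p" if "p \<le> k + 1" for p
    using pos[of 1 p] that frieze_patternD(2)[OF assms] pm[OF e] pm[OF s[of p]] pm[OF s[of "Suc p"]]
    by auto
  have sgn: "s d = \<epsilon> ^ d * s 0" if "d \<le> k + 2" for d
    using that by (induction d) (auto simp: step)
  have row: "\<epsilon> ^ (d + 1) * y 0 d > 0" if "1 \<le> d" "d \<le> k + 2" for d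
    using pos[of d 0] that sgn[of d] pm[OF s[of 0]] by (auto simp: algebra_simps)
  show ?thesis
    using pm[OF e]
  proof
    assume "\<epsilon> = 1"
    then show ?thesis using row by simp
  next
    assume eps: "\<epsilon> = -1"
    then have "(-1::int) ^ (k + 3) > 0"
      using row[of "k + 2"] frieze_patternD(3)[OF assms, of 0] by (simp add: numeral_3_eq_3)
    then have "odd k" by (cases "odd k") auto
    then show ?thesis using row eps by auto
  qed
qed

section \<open>Friezes along mutations\<close>

text \<open>
  The numerator of the exchange relation over an arbitrary ring, so that the same expression can be
  taken in the field of rational functions and, after applying a frieze, in the integers.
\<close>

definition exchange_sum :: "nat \<Rightarrow> nat \<Rightarrow> quiver \<Rightarrow> (nat \<Rightarrow> 'a::comm_semiring_1) \<Rightarrow> 'a" where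
  "exchange_sum k m B a = (\<Prod>i<k. a i ^ nat (B i m)) + (\<Prod>i<k. a i ^ nat (- B i m))"

definition skew_symmetric :: "nat \<Rightarrow> quiver \<Rightarrow> bool" where
  "skew_symmetric k B \<longleftrightarrow> (\<forall>i<k. \<forall>j<k. B j i = - B i j)"

lemma skew_symmetric_diag: "skew_symmetric k B \<Longrightarrow> m < k \<Longrightarrow> B m m = 0"
  unfolding skew_symmetric_def by (metis equal_neg_zero)

lemma exchange_sum_cong:
  assumes "B m m = 0" and "\<And>i. i < k \<Longrightarrow> i \<noteq> m \<Longrightarrow> a i = b i"
  shows "exchange_sum k m B a = exchange_sum k m B b"
proof -
  have "a i ^ nat (B i m) = b i ^ nat (B i m)" "a i ^ nat (- B i m) = b i ^ nat (- B i m)"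
    if "i < k" for i
    using assms that by (cases "i = m"; simp)+
  then show ?thesis unfolding exchange_sum_def by simp
qed

lemma mutate_cluster_other: "i \<noteq> m \<Longrightarrow> mutate_cluster k m B x i = x i"
  by (simp add: mutate_cluster_def)

lemma mutate_cluster_same: "mutate_cluster k m B x m = exchange_sum k m B x / x m"
  by (simp add: mutate_cluster_def exchange_sum_def)

lemma skew_symmetric_mutate:
  assumes "skew_symmetric k B" and "m < k"
  shows "skew_symmetric k (mutate_quiver m B)"
  unfolding skew_symmetric_def
proof (intro allI impI)
  fix i j assume ij: "i < k" "j < k"
  have "B j i = - B i j" "B j m = - B m j" "B m i = - B i m"
    using assms ij unfolding skew_symmetric_def by blast+
  then show "mutate_quiver m B j i = - mutate_quiver m B i j"
    by (auto simp: mutate_quiver_def mult.commute)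
qed

lemma seeds_skew_symmetric:
  assumes "(B, x) \<in> seeds k B0" and "skew_symmetric k B0"
  shows "skew_symmetric k B"
  using assms(1) by (induction rule: seeds.induct) (auto intro: assms(2) skew_symmetric_mutate)

lemma cluster_variableI: "(B, x) \<in> seeds k B0 \<Longrightarrow> i < k \<Longrightarrow> x i \<in> cluster_variables k B0"
  unfolding cluster_variables_def by blast

lemma cluster_algebraI: "x \<in> cluster_variables k B0 \<Longrightarrow> x \<in> cluster_algebra k B0"
  unfolding cluster_algebra_def by (rule generated_subring.gen)

lemma generated_subring_prod:
  "(\<And>i. i \<in> I \<Longrightarrow> a i \<in> generated_subring S) \<Longrightarrow> (\<Prod>i\<in>I. a i) \<in> generated_subring S"
  by (induction I rule: infinite_finite_induct) (auto intro: generated_subring.intros)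

lemma generated_subring_power: "a \<in> generated_subring S \<Longrightarrow> a ^ n \<in> generated_subring S"
  by (induction n) (auto intro: generated_subring.intros)

context
  fixes S :: "'a::comm_ring_1 set" and f :: "'a \<Rightarrow> 'b::comm_ring_1"
  assumes f: "f \<in> ring_homs (generated_subring S)"
begin

lemma ring_hom_one: "f 1 = 1"
  and ring_hom_add: "a \<in> generated_subring S \<Longrightarrow> b \<in> generated_subring S \<Longrightarrow> f (a + b) = f a + f b"
  and ring_hom_mult: "a \<in> generated_subring S \<Longrightarrow> b \<in> generated_subring S \<Longrightarrow> f (a * b) = f a * f b"
  using f by (auto simp: ring_homs_def)

lemma ring_hom_zero: "f 0 = 0"
proof -
  have "(1::'a) + - 1 \<in> generated_subring S"
    by (intro generated_subring.intros)
  then show ?thesis using ring_hom_add[of 0 0] by simp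
qed

lemma ring_hom_uminus: "a \<in> generated_subring S \<Longrightarrow> f (- a) = - f a"
  using ring_hom_add[of a "- a"] ring_hom_zero
  by (simp add: generated_subring.uminus add_eq_0_iff)

lemma ring_hom_power: "a \<in> generated_subring S \<Longrightarrow> f (a ^ n) = f a ^ n"
  by (induction n) (simp_all add: ring_hom_one ring_hom_mult generated_subring_power)

lemma ring_hom_prod:
  "(\<And>i. i \<in> I \<Longrightarrow> a i \<in> generated_subring S) \<Longrightarrow> f (\<Prod>i\<in>I. a i) = (\<Prod>i\<in>I. f (a i))"
  by (induction I rule: infinite_finite_induct)
    (simp_all add: ring_hom_one ring_hom_mult generated_subring_prod)

lemma ring_hom_exchange_sum:
  assumes "\<And>i. i < k \<Longrightarrow> x i \<in> generated_subring S"
  shows "f (exchange_sum k m B x) = exchange_sum k m B (\<lambda>i. f (x i))"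
proof -
  have P: "x i ^ n \<in> generated_subring S" "f (x i ^ n) = f (x i) ^ n" if "i < k" for i n
    using assms[OF that] by (auto intro: generated_subring_power ring_hom_power)
  have "(\<Prod>i<k. x i ^ n i) \<in> generated_subring S" "f (\<Prod>i<k. x i ^ n i) = (\<Prod>i<k. f (x i) ^ n i)" for n
    using P ring_hom_prod[of "{..<k}" "\<lambda>i. x i ^ n i"] by (auto intro: generated_subring_prod)
  then show ?thesis unfolding exchange_sum_def by (simp add: ring_hom_add)
qed

end

text \<open>
  A frieze respects sums and products, so the quotient defining the new variable has to be multiplied
  out. This is possible because the frieze does not vanish on \<open>x m\<close>, which is therefore not zero.
\<close>

lemma frieze_exchange:
  assumes "f \<in> nonzero_friezes k B0" and "(B, x) \<in> seeds k B0" and "m < k"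
  shows "f (mutate_cluster k m B x m) * f (x m) = exchange_sum k m B (\<lambda>i. f (x i))"
proof -
  have f: "f \<in> ring_homs (generated_subring (cluster_variables k B0))"
    using assms(1) by (simp add: nonzero_friezes_def cluster_algebra_def)
  have x: "x i \<in> generated_subring (cluster_variables k B0)" if "i < k" for i
    using cluster_algebraI[OF cluster_variableI[OF assms(2) that]] by (simp add: cluster_algebra_def)
  have x': "mutate_cluster k m B x m \<in> generated_subring (cluster_variables k B0)"
    using cluster_algebraI[OF cluster_variableI[OF seeds.mutation[OF assms(2,3)] assms(3)]]
    by (simp add: cluster_algebra_def)
  have "f (x m) \<noteq> 0"
    using assms(1) cluster_variableI[OF assms(2,3)] by (simp add: nonzero_friezes_def)
  then have "x m \<noteq> 0" using ring_hom_zero[OF f] by auto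
  then have "mutate_cluster k m B x m * x m = exchange_sum k m B x"
    by (simp add: mutate_cluster_same)
  then have "f (mutate_cluster k m B x m) * f (x m) = f (exchange_sum k m B x)"
    using ring_hom_mult[OF f x' x[OF assms(3)]] by simp
  then show ?thesis using ring_hom_exchange_sum[OF f x] by simp
qed

lemma frieze_nonzero:
  "f \<in> nonzero_friezes k B0 \<Longrightarrow> (B, x) \<in> seeds k B0 \<Longrightarrow> i < k \<Longrightarrow> f (x i) \<noteq> 0"
  using cluster_variableI by (fastforce simp: nonzero_friezes_def)

lemma exchange_sum_pos:
  fixes a :: "nat \<Rightarrow> int"
  assumes "B m m = 0" and "\<And>i. i < k \<Longrightarrow> i \<noteq> m \<Longrightarrow> a i > 0"
  shows "exchange_sum k m B a > 0"
proof -
  have "exchange_sum k m B a = exchange_sum k m B (a(m := 1))"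
    using assms(1) by (intro exchange_sum_cong) auto
  also have "\<dots> > 0"
    unfolding exchange_sum_def using assms(2) by (intro add_pos_pos prod_pos) auto
  finally show ?thesis .
qed

text \<open>
  The right-hand side of an exchange relation involves only the variables shared by both seeds, and it
  is positive when these are. So the two exchanged values have the same sign, and positivity passes
  through a mutation in both directions.
\<close>

lemma frieze_pos_transport:
  assumes "f \<in> nonzero_friezes k B0" and "skew_symmetric k B0" and "(B, x) \<in> seeds k B0"
  shows "(\<forall>i<k. f (x i) > 0) \<longleftrightarrow> (\<forall>i<k. f (initial_variable i) > 0)"
  using assms(3)
proof (induction rule: seeds.induct)
  case initial
  then show ?case by simp
next
  case (mutation B x m)
  let ?x' = "mutate_cluster k m B x"
  have ex: "f (?x' m) * f (x m) = exchange_sum k m B (\<lambda>i. f (x i))"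
    using frieze_exchange[OF assms(1) mutation.hyps] .
  have diag: "B m m = 0"
    using skew_symmetric_diag seeds_skew_symmetric mutation.hyps assms(2) by blast
  have pos: "f (?x' m) * f (x m) > 0" if "\<And>i. i < k \<Longrightarrow> i \<noteq> m \<Longrightarrow> f (x i) > 0"
    unfolding ex using diag that by (rule exchange_sum_pos)
  have "(\<forall>i<k. f (?x' i) > 0) \<longleftrightarrow> (\<forall>i<k. f (x i) > 0)"
    using pos mutate_cluster_other[of _ m k B x] mutation.hyps(2)
    by (metis zero_less_mult_pos zero_less_mult_pos2)
  then show ?case using mutation.IH by simp
qed

lemma positive_frieze_iff:
  assumes "f \<in> nonzero_friezes k B0" and "skew_symmetric k B0" and "(B, x) \<in> seeds k B0"
  shows "f \<in> positive_friezes k B0 \<longleftrightarrow> (\<forall>i<k. f (x i) > 0)"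
proof
  show "\<forall>i<k. f (x i) > 0" if "f \<in> positive_friezes k B0"
    using that cluster_variableI[OF assms(3)] by (simp add: positive_friezes_def)
next
  assume "\<forall>i<k. f (x i) > 0"
  then have "\<forall>i<k. f (y i) > 0" if "(C, y) \<in> seeds k B0" for C y
    using frieze_pos_transport[OF assms(1,2)] assms(3) that by blast
  then show "f \<in> positive_friezes k B0"
    using assms(1) by (auto simp: positive_friezes_def nonzero_friezes_def cluster_variables_def)
qed

text \<open>
  The same argument with cancellation of a non-zero factor in place of signs.
\<close>

lemma frieze_agree_transport:
  assumes "f \<in> nonzero_friezes k B0" and "g \<in> nonzero_friezes k B0" and "skew_symmetric k B0"
    and "(B, x) \<in> seeds k B0"
  shows "(\<forall>i<k. f (x i) = g (x i)) \<longleftrightarrow> (\<forall>i<k. f (initial_variable i) = g (initial_variable i))"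
  using assms(4)
proof (induction rule: seeds.induct)
  case initial
  then show ?case by simp
next
  case (mutation B x m)
  let ?x' = "mutate_cluster k m B x"
  have diag: "B m m = 0"
    using skew_symmetric_diag seeds_skew_symmetric mutation.hyps assms(3) by blast
  have eq: "f (?x' m) * f (x m) = g (?x' m) * g (x m)"
    if "\<And>i. i < k \<Longrightarrow> i \<noteq> m \<Longrightarrow> f (x i) = g (x i)"
    using frieze_exchange[OF assms(1) mutation.hyps] frieze_exchange[OF assms(2) mutation.hyps]
      exchange_sum_cong[of B m k "\<lambda>i. f (x i)" "\<lambda>i. g (x i)"] diag that by simp
  have "f (x m) \<noteq> 0" "f (?x' m) \<noteq> 0"
    using frieze_nonzero[OF assms(1)] mutation.hyps seeds.mutation by blast+
  then have "(\<forall>i<k. f (?x' i) = g (?x' i)) \<longleftrightarrow> (\<forall>i<k. f (x i) = g (x i))"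
    using eq mutate_cluster_other[of _ m k B x] mutation.hyps(2)
    by (metis mult_cancel_left mult_cancel_right)
  then show ?case using mutation.IH by simp
qed

lemma frieze_eqI:
  assumes "f \<in> nonzero_friezes k B0" and "g \<in> nonzero_friezes k B0" and "skew_symmetric k B0"
    and "(B, x) \<in> seeds k B0" and "\<And>i. i < k \<Longrightarrow> f (x i) = g (x i)"
  shows "f = g"
proof -
  let ?V = "cluster_variables k B0"
  have f: "f \<in> ring_homs (generated_subring ?V)" and g: "g \<in> ring_homs (generated_subring ?V)"
    using assms(1,2) by (auto simp: nonzero_friezes_def cluster_algebra_def)
  have "\<forall>i<k. f (y i) = g (y i)" if "(C, y) \<in> seeds k B0" for C y
    using frieze_agree_transport[OF assms(1-3)] assms(4,5) that by blast
  then have gen: "f v = g v" if "v \<in> ?V" for v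
    using that by (auto simp: cluster_variables_def)
  have "f a = g a" if "a \<in> generated_subring ?V" for a
    using that
    by induction (simp_all add: gen ring_hom_one[OF f] ring_hom_one[OF g] ring_hom_uminus[OF f]
        ring_hom_uminus[OF g] ring_hom_add[OF f] ring_hom_add[OF g] ring_hom_mult[OF f] ring_hom_mult[OF g])
  then show ?thesis
    using f g by (intro extensionalityI[of f "generated_subring ?V"]) (auto simp: ring_homs_def)
qed

section \<open>Sign changes of the initial variables\<close>

text \<open>
  Composition with such an involution turns friezes with alternating signs into positive ones.
\<close>

definition sign_automorphism :: "(nat \<Rightarrow> nat) \<Rightarrow> nat \<Rightarrow> ('a::field \<Rightarrow> 'a) \<Rightarrow> (nat \<Rightarrow> 'a) \<Rightarrow> bool" where
  "sign_automorphism e k \<sigma> X \<longleftrightarrow>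
     \<sigma> 1 = 1 \<and> (\<forall>a b. \<sigma> (a + b) = \<sigma> a + \<sigma> b) \<and> (\<forall>a b. \<sigma> (a * b) = \<sigma> a * \<sigma> b) \<and>
     (\<forall>a. \<sigma> (\<sigma> a) = a) \<and> (\<forall>i<k. \<sigma> (X i) = (-1) ^ e i * X i)"

lemma poly_mapping_induct_add:
  fixes p :: "'a \<Rightarrow>\<^sub>0 'b::comm_monoid_add"
  assumes "P 0" and "\<And>m c. P (Poly_Mapping.single m c)" and "\<And>p q. P p \<Longrightarrow> P q \<Longrightarrow> P (p + q)"
  shows "P p"
proof (induction p rule: update_induct)
  case const
  then show ?case by (rule assms(1))
next
  case (update f a b)
  have "Poly_Mapping.update a b f = Poly_Mapping.single a b + f"
    using update(1) by (intro poly_mapping_eqI)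
      (auto simp: lookup_update lookup_add lookup_single in_keys_iff when_def)
  then show ?case using assms update by simp
qed

text \<open>
  For a multiplicative \<open>\<chi>\<close> on the exponents this is the substitution that multiplies each variable by
  the value of \<open>\<chi>\<close> at its exponent.
\<close>

definition scale_coeffs :: "('a \<Rightarrow> int) \<Rightarrow> ('a \<Rightarrow>\<^sub>0 int) \<Rightarrow> ('a \<Rightarrow>\<^sub>0 int)" where
  "scale_coeffs \<chi> p = Poly_Mapping.mapp (\<lambda>m c. \<chi> m * c) p"

lemma lookup_scale_coeffs: "Poly_Mapping.lookup (scale_coeffs \<chi> p) m = \<chi> m * Poly_Mapping.lookup p m"
  by (simp add: scale_coeffs_def lookup_mapp when_def in_keys_iff)

lemma scale_coeffs_zero: "scale_coeffs \<chi> 0 = 0"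
  by (rule poly_mapping_eqI) (simp add: lookup_scale_coeffs)

lemma scale_coeffs_add: "scale_coeffs \<chi> (p + q) = scale_coeffs \<chi> p + scale_coeffs \<chi> q"
  by (rule poly_mapping_eqI) (simp add: lookup_scale_coeffs lookup_add algebra_simps)

lemma scale_coeffs_single: "scale_coeffs \<chi> (Poly_Mapping.single m c) = Poly_Mapping.single m (\<chi> m * c)"
  by (rule poly_mapping_eqI) (simp add: lookup_scale_coeffs lookup_single when_def)

lemma scale_coeffs_mult:
  fixes \<chi> :: "'a::comm_monoid_add \<Rightarrow> int"
  assumes "\<And>m n. \<chi> (m + n) = \<chi> m * \<chi> n"
  shows "scale_coeffs \<chi> (p * q) = scale_coeffs \<chi> p * scale_coeffs \<chi> q"
proof (induction p rule: poly_mapping_induct_add)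
  case (2 m c)
  show ?case
    by (induction q rule: poly_mapping_induct_add)
      (simp_all add: scale_coeffs_zero scale_coeffs_single mult_single assms scale_coeffs_add algebra_simps)
qed (simp_all add: scale_coeffs_zero scale_coeffs_add algebra_simps)

lemma scale_coeffs_scale_coeffs:
  assumes "\<And>m. \<chi> m * \<chi> m = 1"
  shows "scale_coeffs \<chi> (scale_coeffs \<chi> p) = p"
  by (rule poly_mapping_eqI) (simp add: lookup_scale_coeffs assms flip: mult.assoc)

text \<open>
  For an injective ring endomorphism \<open>h\<close> the result does not depend on the fraction chosen to represent
  \<open>q\<close>, and this is the extension of \<open>h\<close> to the field of fractions.
\<close>

definition map_fract :: "('a::idom \<Rightarrow> 'a) \<Rightarrow> 'a fract \<Rightarrow> 'a fract" where
  "map_fract h q = (SOME r. \<exists>a b. b \<noteq> 0 \<and> q = Fract a b \<and> r = Fract (h a) (h b))"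

lemma map_fract_Fract:
  assumes "\<And>a b. h (a * b) = h a * h b" and "\<And>a. h a = 0 \<longleftrightarrow> a = 0" and "b \<noteq> 0"
  shows "map_fract h (Fract a b) = Fract (h a) (h b)"
  unfolding map_fract_def
proof (rule someI2)
  show "\<exists>a' b'. b' \<noteq> 0 \<and> Fract a b = Fract a' b' \<and> Fract (h a) (h b) = Fract (h a') (h b')"
    using assms(3) by blast
next
  fix r assume "\<exists>a' b'. b' \<noteq> 0 \<and> Fract a b = Fract a' b' \<and> r = Fract (h a') (h b')"
  then obtain a' b' where "b' \<noteq> 0" "Fract a b = Fract a' b'" and r: "r = Fract (h a') (h b')"
    by blast
  then have "a * b' = a' * b" using assms(3) by (simp add: eq_fract)
  then have "h a * h b' = h a' * h b" by (metis assms(1))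
  then show "r = Fract (h a) (h b)"
    using \<open>b' \<noteq> 0\<close> assms(2,3) r by (simp add: eq_fract)
qed

lemma sign_automorphism_exists:
  "\<exists>\<sigma>. sign_automorphism e k \<sigma> initial_variable"
proof -
  define \<chi> :: "(nat \<Rightarrow>\<^sub>0 nat) \<Rightarrow> int"
    where "\<chi> m = (-1) ^ (\<Sum>i<k. e i * Poly_Mapping.lookup m i)" for m
  have \<chi>_add: "\<chi> (m + n) = \<chi> m * \<chi> n" for m n
    by (simp add: \<chi>_def lookup_add algebra_simps sum.distrib power_add)
  have \<chi>_sq: "\<chi> m * \<chi> m = 1" for m
    by (simp add: \<chi>_def flip: power_mult_distrib)
  let ?h = "scale_coeffs \<chi>" and ?\<sigma> = "map_fract (scale_coeffs \<chi>)"
  have h_mult: "?h (a * b) = ?h a * ?h b" for a b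
    using \<chi>_add by (rule scale_coeffs_mult)
  have h_invol: "?h (?h a) = a" for a
    using \<chi>_sq by (rule scale_coeffs_scale_coeffs)
  have h_0: "?h a = 0 \<longleftrightarrow> a = 0" for a
    by (metis h_invol scale_coeffs_zero)
  have \<sigma>: "?\<sigma> (Fract a b) = Fract (?h a) (?h b)" if "b \<noteq> 0" for a b
    using h_mult h_0 that by (rule map_fract_Fract)
  have h_1: "?h 1 = 1"
    by (metis h_invol h_mult mult.left_neutral mult.right_neutral)
  have "?\<sigma> 1 = 1"
    using \<sigma>[of 1 1] by (simp add: One_fract_def h_1)
  moreover have "?\<sigma> (p + q) = ?\<sigma> p + ?\<sigma> q" for p q
    by (cases p; cases q) (simp add: \<sigma> h_0 h_mult scale_coeffs_add)
  moreover have "?\<sigma> (p * q) = ?\<sigma> p * ?\<sigma> q" for p q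
    by (cases p; cases q) (simp add: \<sigma> h_0 h_mult)
  moreover have "?\<sigma> (?\<sigma> q) = q" for q
    by (cases q) (simp add: \<sigma> h_0 h_invol)
  moreover have "?\<sigma> (initial_variable i) = (-1) ^ e i * initial_variable i" if "i < k" for i
  proof -
    have "\<chi> (Poly_Mapping.single i 1) = (-1) ^ e i"
      using that by (simp add: \<chi>_def lookup_single when_def if_distrib sum.delta cong: if_cong)
    then have "?\<sigma> (initial_variable i) =
        Fract (Poly_Mapping.single (Poly_Mapping.single i 1) ((-1) ^ e i)) 1"
      by (simp add: initial_variable_def \<sigma> h_1 scale_coeffs_single)
    then show ?thesis
      by (cases "even (e i)") (simp_all add: initial_variable_def single_uminus minus_fract)
  qed
  ultimately have "sign_automorphism e k ?\<sigma> initial_variable"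
    unfolding sign_automorphism_def by blast
  then show ?thesis by blast
qed

section \<open>Gradings modulo 2 and twisted friezes\<close>

text \<open>
  The parities of \<open>e\<close> form a grading of the seed modulo \<open>2\<close>: the second condition says that the two
  monomials of every exchange relation have the same parity, so that \<open>\<sigma>\<close> multiplies the new variable
  by a sign as well.
\<close>

definition graded :: "(rat_fun \<Rightarrow> rat_fun) \<Rightarrow> nat \<Rightarrow> (nat \<Rightarrow> nat) \<Rightarrow> quiver \<Rightarrow> (nat \<Rightarrow> rat_fun) \<Rightarrow> bool" where
  "graded \<sigma> k e B x \<longleftrightarrow>
     (\<forall>i<k. \<sigma> (x i) = (-1) ^ e i * x i) \<and> (\<forall>j<k. even (\<Sum>i<k. B i j * int (e i)))"

context
  fixes \<sigma> :: "rat_fun \<Rightarrow> rat_fun" and k :: nat and e :: "nat \<Rightarrow> nat"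
  assumes \<sigma>: "sign_automorphism e k \<sigma> initial_variable"
begin

lemma sign_automorphism_one: "\<sigma> 1 = 1" and sign_automorphism_add: "\<sigma> (a + b) = \<sigma> a + \<sigma> b" and sign_automorphism_mult: "\<sigma> (a * b) = \<sigma> a * \<sigma> b"
  and sign_automorphism_invol: "\<sigma> (\<sigma> a) = a"
  using \<sigma> by (auto simp: sign_automorphism_def)

lemma sign_automorphism_zero: "\<sigma> 0 = 0"
  using sign_automorphism_add[of 0 0] by (metis add.right_neutral add_left_cancel)

lemma sign_automorphism_uminus: "\<sigma> (- a) = - \<sigma> a"
  using sign_automorphism_add[of a "- a"] by (simp add: sign_automorphism_zero add_eq_0_iff)

lemma sign_automorphism_divide: "\<sigma> (a / b) = \<sigma> a / \<sigma> b"
proof (cases "b = 0")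
  case False
  then have "\<sigma> b \<noteq> 0" by (metis sign_automorphism_invol sign_automorphism_zero)
  then show ?thesis using sign_automorphism_mult[of "a / b" b] False by (simp add: nonzero_eq_divide_eq)
qed (simp add: sign_automorphism_zero)

lemma sign_automorphism_power: "\<sigma> (a ^ n) = \<sigma> a ^ n"
  by (induction n) (simp_all add: sign_automorphism_one sign_automorphism_mult)

lemma sign_automorphism_prod: "\<sigma> (\<Prod>i\<in>I. a i) = (\<Prod>i\<in>I. \<sigma> (a i))"
  by (induction I rule: infinite_finite_induct) (simp_all add: sign_automorphism_one sign_automorphism_mult)

lemma graded_monomial:
  assumes "graded \<sigma> k e' B x"
  shows "\<sigma> (\<Prod>i<k. x i ^ n i) = (-1) ^ (\<Sum>i<k. n i * e' i) * (\<Prod>i<k. x i ^ n i)"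
proof -
  have "\<sigma> (\<Prod>i<k. x i ^ n i) = (\<Prod>i<k. ((-1) ^ e' i * x i) ^ n i)"
    using assms by (simp add: sign_automorphism_prod sign_automorphism_power graded_def)
  then show ?thesis
    by (simp add: power_mult_distrib prod.distrib power_sum mult.commute flip: power_mult)
qed

lemma graded_column:
  assumes "graded \<sigma> k e' B x" and "m < k"
  shows "even (\<Sum>i<k. nat (B i m) * e' i) \<longleftrightarrow> even (\<Sum>i<k. nat (- B i m) * e' i)"
proof -
  have nat_parts: "int (nat b) - int (nat (- b)) = b" for b
    by simp
  have "int (\<Sum>i<k. nat (B i m) * e' i) - int (\<Sum>i<k. nat (- B i m) * e' i) = (\<Sum>i<k. B i m * int (e' i))"
    by (simp add: sum_subtractf[symmetric] left_diff_distrib[symmetric] nat_parts del: int_nat_eq)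
  then have "even (int (\<Sum>i<k. nat (B i m) * e' i) - int (\<Sum>i<k. nat (- B i m) * e' i))"
    using assms by (simp add: graded_def)
  then show ?thesis by (simp del: of_nat_sum of_nat_mult)
qed

text \<open>
  The new variable gets the degree of the exchange numerator minus the degree of the old one, and modulo
  \<open>2\<close> the difference may be replaced by the sum. In a column \<open>j \<noteq> m\<close> of the mutated quiver the arrows
  created by mutation and the new degree at \<open>m\<close> together contribute, up to even terms, a multiple of the
  difference of the degrees of the two monomials, which is even.
\<close>

lemma graded_mutate:
  assumes "graded \<sigma> k e' B x" and "m < k" and "skew_symmetric k B"
    and "e'' = e'(m := e' m + (\<Sum>i<k. nat (B i m) * e' i))"
  shows "graded \<sigma> k e'' (mutate_quiver m B) (mutate_cluster k m B x)"
  unfolding graded_def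
proof (intro conjI allI impI)
  let ?Sp = "\<Sum>i<k. nat (B i m) * e' i" and ?Sm = "\<Sum>i<k. nat (- B i m) * e' i"
  have diag: "B m m = 0" using skew_symmetric_diag[OF assms(3,2)] .
  have par: "even ?Sp \<longleftrightarrow> even ?Sm" using graded_column[OF assms(1,2)] .
  {
    fix i assume i: "i < k"
    show "\<sigma> (mutate_cluster k m B x i) = (-1) ^ e'' i * mutate_cluster k m B x i"
    proof (cases "i = m")
      case False
      then show ?thesis using assms(1,4) i by (simp add: mutate_cluster_other graded_def)
    next
      case True
      have "(-1) ^ ?Sm = ((-1) ^ ?Sp :: rat_fun)" using par by (simp add: minus_one_power_iff)
      then have "\<sigma> (exchange_sum k m B x) = (-1) ^ ?Sp * exchange_sum k m B x"
        by (simp add: exchange_sum_def sign_automorphism_add graded_monomial[OF assms(1)] distrib_left)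
      moreover have "\<sigma> (x m) = (-1) ^ e' m * x m" using assms(1,2) by (simp add: graded_def)
      ultimately show ?thesis
        unfolding True mutate_cluster_same sign_automorphism_divide assms(4)
        by (cases "even (e' m)") (simp_all add: power_add)
    qed
  }
  fix j assume j: "j < k"
  let ?B = "mutate_quiver m B"
  show "even (\<Sum>i<k. ?B i j * int (e'' i))"
  proof (cases "j = m")
    case True
    have "(\<Sum>i<k. ?B i j * int (e'' i)) = (\<Sum>i<k. - (B i m * int (e' i)))"
      using diag by (intro sum.cong) (auto simp: True mutate_quiver_def assms(4))
    then show ?thesis using assms(1,2) by (simp add: sum_negf graded_def)
  next
    case False
    let ?p = "max 0 (B m j)" and ?n = "max 0 (- B m j)"
    have pn: "?p = B m j + ?n" by simp
    have "(\<Sum>i<k. ?B i j * int (e'' i)) =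
      (\<Sum>i<k. B i j * int (e' i) + ?p * int (nat (B i m) * e' i) - ?n * int (nat (- B i m) * e' i)
         - (if i = m then B m j * (2 * int (e' m) + int ?Sp) else 0))"
      using diag False
      by (intro sum.cong) (auto simp: mutate_quiver_def assms(4) algebra_simps max_def)
    also have "\<dots> = (\<Sum>i<k. B i j * int (e' i)) + ?p * int ?Sp - ?n * int ?Sm
        - B m j * (2 * int (e' m) + int ?Sp)"
      using assms(2)
      by (simp add: sum.distrib sum_subtractf sum_distrib_left sum.delta del: int_nat_eq)
    also have "\<dots> = (\<Sum>i<k. B i j * int (e' i)) + ?n * (int ?Sp - int ?Sm) - B m j * (2 * int (e' m))"
      unfolding pn by (simp add: algebra_simps del: of_nat_sum of_nat_mult int_nat_eq)
    finally show ?thesis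
      using par assms(1) j by (simp add: graded_def del: of_nat_sum of_nat_mult)
  qed
qed

lemma seeds_graded:
  assumes "(B, x) \<in> seeds k B0" and "skew_symmetric k B0" and "graded \<sigma> k e B0 initial_variable"
  shows "\<exists>e'. graded \<sigma> k e' B x"
  using assms(1)
proof (induction rule: seeds.induct)
  case initial
  then show ?case using assms(3) by blast
next
  case (mutation B x m)
  then show ?case using graded_mutate seeds_skew_symmetric assms(2) by blast
qed

lemma sign_automorphism_cluster_variable:
  assumes "v \<in> cluster_variables k B0" and "skew_symmetric k B0" and "graded \<sigma> k e B0 initial_variable"
  shows "\<sigma> v = v \<or> \<sigma> v = - v"
proof -
  obtain B x i where "(B, x) \<in> seeds k B0" "i < k" and v: "v = x i"
    using assms(1) by (auto simp: cluster_variables_def)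
  then obtain e' where "graded \<sigma> k e' B x"
    using seeds_graded[OF _ assms(2,3)] by blast
  then have "\<sigma> v = (-1) ^ e' i * v" using \<open>i < k\<close> by (simp add: v graded_def)
  then show ?thesis by (cases "even (e' i)") auto
qed

lemma sign_automorphism_cluster_algebra:
  assumes "a \<in> cluster_algebra k B0" and "skew_symmetric k B0" and "graded \<sigma> k e B0 initial_variable"
  shows "\<sigma> a \<in> cluster_algebra k B0"
  using assms(1) unfolding cluster_algebra_def
proof induction
  case (gen a)
  then show ?case
    using sign_automorphism_cluster_variable[OF gen assms(2,3)] generated_subring.gen[OF gen]
      generated_subring.uminus[OF generated_subring.gen[OF gen]] by auto
qed (auto simp: sign_automorphism_one sign_automorphism_uminus sign_automorphism_add sign_automorphism_mult intro: generated_subring.intros)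

text \<open>
  Composition of a frieze with \<open>\<sigma>\<close>; the restriction keeps the value outside the cluster algebra
  undefined, as counting requires.
\<close>

definition twist_frieze :: "quiver \<Rightarrow> (rat_fun \<Rightarrow> int) \<Rightarrow> rat_fun \<Rightarrow> int" where
  "twist_frieze B0 f = restrict (\<lambda>a. f (\<sigma> a)) (cluster_algebra k B0)"

lemma twist_frieze_nonzero:
  assumes "f \<in> nonzero_friezes k B0" and "skew_symmetric k B0" and "graded \<sigma> k e B0 initial_variable"
  shows "twist_frieze B0 f \<in> nonzero_friezes k B0"
proof -
  let ?A = "cluster_algebra k B0"
  have f: "f \<in> ring_homs ?A" and nz: "\<And>v. v \<in> cluster_variables k B0 \<Longrightarrow> f v \<noteq> 0"
    using assms(1) by (auto simp: nonzero_friezes_def)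
  have f': "f \<in> ring_homs (generated_subring (cluster_variables k B0))"
    using f by (simp add: cluster_algebra_def)
  have "1 \<in> ?A" "\<And>a b. a \<in> ?A \<Longrightarrow> b \<in> ?A \<Longrightarrow> a + b \<in> ?A \<and> a * b \<in> ?A"
    unfolding cluster_algebra_def by (auto intro: generated_subring.intros)
  then have "twist_frieze B0 f \<in> ring_homs ?A"
    using f sign_automorphism_cluster_algebra[OF _ assms(2,3)]
    by (auto simp: ring_homs_def twist_frieze_def sign_automorphism_one sign_automorphism_add sign_automorphism_mult)
  moreover have "twist_frieze B0 f v \<noteq> 0" if v: "v \<in> cluster_variables k B0" for v
  proof -
    have "v \<in> ?A" using v by (rule cluster_algebraI)
    moreover from this have "f (- v) = - f v"
      using ring_hom_uminus[OF f'] by (simp add: cluster_algebra_def)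
    ultimately show ?thesis
      using sign_automorphism_cluster_variable[OF v assms(2,3)] nz[OF v] by (auto simp: twist_frieze_def)
  qed
  ultimately show ?thesis by (simp add: nonzero_friezes_def)
qed

lemma twist_frieze_twist_frieze:
  assumes "f \<in> nonzero_friezes k B0" and "skew_symmetric k B0" and "graded \<sigma> k e B0 initial_variable"
  shows "twist_frieze B0 (twist_frieze B0 f) = f"
proof -
  have "f \<in> extensional (cluster_algebra k B0)"
    using assms(1) by (simp add: nonzero_friezes_def ring_homs_def)
  then show ?thesis
    using sign_automorphism_cluster_algebra[OF _ assms(2,3)]
    by (intro ext) (auto simp: twist_frieze_def sign_automorphism_invol extensional_def)
qed

lemma twist_frieze_seed:
  assumes "f \<in> nonzero_friezes k B0" and "(B, x) \<in> seeds k B0" and "graded \<sigma> k e' B x" and "i < k"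
  shows "twist_frieze B0 f (x i) = (-1) ^ e' i * f (x i)"
proof -
  have x: "x i \<in> cluster_algebra k B0"
    using cluster_algebraI cluster_variableI assms(2,4) by blast
  moreover have "f (- x i) = - f (x i)"
    using ring_hom_uminus[of f "cluster_variables k B0" "x i"] assms(1) x
    by (simp add: nonzero_friezes_def cluster_algebra_def)
  moreover have "\<sigma> (x i) = (-1) ^ e' i * x i" using assms(3,4) by (simp add: graded_def)
  ultimately show ?thesis by (cases "even (e' i)") (auto simp: twist_frieze_def)
qed

end

section \<open>Mutations at sinks and sources\<close>

text \<open>
  The orientation is recorded by the sequence \<open>c\<close>, where \<open>c i = 1\<close> stands for the arrow \<open>i \<rightarrow> i + 1\<close> and
  \<open>c i = -1\<close> for the arrow \<open>i + 1 \<rightarrow> i\<close>.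
\<close>

definition path_quiver :: "nat \<Rightarrow> (nat \<Rightarrow> int) \<Rightarrow> quiver \<Rightarrow> bool" where
  "path_quiver k c B \<longleftrightarrow>
     (\<forall>i. Suc i < k \<longrightarrow> \<bar>c i\<bar> = 1) \<and>
     (\<forall>i<k. \<forall>j<k. B i j = (if j = Suc i then c i else if i = Suc j then - c j else 0))"

lemma path_quiver_of_orientation:
  assumes "orientation_of_A k B"
  shows "path_quiver k (\<lambda>i. B i (Suc i)) B"
proof -
  have B: "B j i = - B i j" "\<bar>B i j\<bar> = (if j = Suc i \<or> i = Suc j then 1 else 0)"
    if "i < k" "j < k" for i j
    using assms that unfolding orientation_of_A_def by blast+
  have "\<bar>B i (Suc i)\<bar> = 1" if "Suc i < k" for i
    using B(2)[of i "Suc i"] that by simp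
  moreover have "B i j = (if j = Suc i then B i (Suc i) else if i = Suc j then - B j (Suc j) else 0)"
    if "i < k" "j < k" for i j
  proof -
    consider "j = Suc i" | "i = Suc j" | "j \<noteq> Suc i" "i \<noteq> Suc j" by blast
    then show ?thesis
    proof cases
      case 2
      then show ?thesis using B(1)[of j i] that by simp
    next
      case 3
      then show ?thesis using B(2)[of i j] that by simp
    qed simp
  qed
  ultimately show ?thesis unfolding path_quiver_def by blast
qed

lemma path_quiver_cong:
  assumes "path_quiver k c B" and "\<And>i. Suc i < k \<Longrightarrow> c i = c' i"
  shows "path_quiver k c' B"
proof -
  have "(if j = Suc i then c i else if i = Suc j then - c j else 0) =
      (if j = Suc i then c' i else if i = Suc j then - c' j else 0)" if "i < k" "j < k" for i j
    using assms(2) that by simp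
  then show ?thesis using assms unfolding path_quiver_def by simp
qed

definition sink_or_source :: "nat \<Rightarrow> quiver \<Rightarrow> nat \<Rightarrow> bool" where
  "sink_or_source k B m \<longleftrightarrow> (\<forall>i<k. 0 \<le> B i m) \<or> (\<forall>i<k. B i m \<le> 0)"

text \<open>
  Mutation at a sink or a source only reverses arrows, so the seeds reached in this way from an
  orientation of the path have orientations of the path as quivers.
\<close>

inductive_set sink_source_seeds :: "nat \<Rightarrow> quiver \<Rightarrow> seed set" for k B0 where
  initial: "(B0, initial_variable) \<in> sink_source_seeds k B0"
| mutation: "(B, x) \<in> sink_source_seeds k B0 \<Longrightarrow> m < k \<Longrightarrow> sink_or_source k B m \<Longrightarrow>
    (mutate_quiver m B, mutate_cluster k m B x) \<in> sink_source_seeds k B0"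

lemma sink_source_seeds_seeds: "(B, x) \<in> sink_source_seeds k B0 \<Longrightarrow> (B, x) \<in> seeds k B0"
  by (induction rule: sink_source_seeds.induct) (auto intro: seeds.intros)

lemma path_quiver_column:
  assumes "path_quiver k c B" and "m < k" and "0 < m \<Longrightarrow> Suc m < k \<Longrightarrow> c (m - 1) = - c m"
  obtains \<eta> where "\<bar>\<eta>\<bar> = 1" and "\<And>i. i < k \<Longrightarrow> B i m = (if Suc i = m \<or> i = Suc m then \<eta> else 0)"
proof -
  have unit: "\<bar>c i\<bar> = 1" if "Suc i < k" for i
    using assms(1) that by (simp add: path_quiver_def)
  have B: "B i m = (if m = Suc i then c i else if i = Suc m then - c m else 0)" if "i < k" for i
    using assms(1,2) that by (simp add: path_quiver_def)
  consider "Suc m < k" | "\<not> Suc m < k" "0 < m" | "\<not> Suc m < k" "m = 0" by auto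
  then show thesis
  proof cases
    case 1
    show thesis
    proof (rule that)
      show "\<bar>- c m\<bar> = 1" using unit[OF 1] by simp
      show "B i m = (if Suc i = m \<or> i = Suc m then - c m else 0)" if "i < k" for i
        unfolding B[OF that] using assms(3)[OF _ 1] by (cases "m = Suc i") simp_all
    qed
  next
    case 2
    show thesis
    proof (rule that)
      show "\<bar>c (m - 1)\<bar> = 1" using unit[of "m - 1"] assms(2) 2 by simp
      show "B i m = (if Suc i = m \<or> i = Suc m then c (m - 1) else 0)" if "i < k" for i
        unfolding B[OF that] using that 2 by (cases "m = Suc i") simp_all
    qed
  next
    case 3
    show thesis
    proof (rule that)
      show "\<bar>1::int\<bar> = 1" by simp
      show "B i m = (if Suc i = m \<or> i = Suc m then 1 else 0)" if "i < k" for i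
        unfolding B[OF that] using that 3 by simp
    qed
  qed
qed

text \<open>
  At a sink or a source one of the two exchange monomials is empty, which produces the summand \<open>1\<close> of
  the unimodular rule.
\<close>

lemma exchange_sum_path:
  assumes "path_quiver k c B" and "m < k" and "0 < m \<Longrightarrow> Suc m < k \<Longrightarrow> c (m - 1) = - c m"
  shows "exchange_sum k m B a =
    1 + (if m = 0 then 1 else a (m - 1)) * (if Suc m < k then a (Suc m) else 1)"
proof -
  obtain \<eta> where \<eta>: "\<bar>\<eta>\<bar> = 1"
    and col: "\<And>i. i < k \<Longrightarrow> B i m = (if Suc i = m \<or> i = Suc m then \<eta> else 0)"
    using path_quiver_column[OF assms] by blast
  let ?N = "{i \<in> {..<k}. Suc i = m \<or> i = Suc m}"
  have nb: "(\<Prod>i<k. if Suc i = m \<or> i = Suc m then a i else 1) =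
      (if m = 0 then 1 else a (m - 1)) * (if Suc m < k then a (Suc m) else 1)"
  proof -
    have "(\<Prod>i<k. if Suc i = m \<or> i = Suc m then a i else 1) = prod a ?N"
      by (rule prod.inter_filter[symmetric]) simp
    also have "?N = (if m = 0 then {} else {m - 1}) \<union> (if Suc m < k then {Suc m} else {})"
      using assms(2) by auto
    also have "prod a \<dots> = (if m = 0 then 1 else a (m - 1)) * (if Suc m < k then a (Suc m) else 1)"
      by (subst prod.union_disjoint) auto
    finally show ?thesis .
  qed
  have "\<eta> = 1 \<or> \<eta> = -1" using \<eta> by linarith
  then show ?thesis
  proof
    assume "\<eta> = 1"
    then have "(\<Prod>i<k. a i ^ nat (B i m)) = (\<Prod>i<k. if Suc i = m \<or> i = Suc m then a i else 1)"
      "(\<Prod>i<k. a i ^ nat (- B i m)) = 1"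
      using col by (auto intro!: prod.cong prod.neutral)
    then show ?thesis by (simp add: exchange_sum_def nb add.commute)
  next
    assume "\<eta> = -1"
    then have "(\<Prod>i<k. a i ^ nat (- B i m)) = (\<Prod>i<k. if Suc i = m \<or> i = Suc m then a i else 1)"
      "(\<Prod>i<k. a i ^ nat (B i m)) = 1"
      using col by (auto intro!: prod.cong prod.neutral)
    then show ?thesis by (simp add: exchange_sum_def nb)
  qed
qed

text \<open>
  The condition on \<open>c\<close> says that the arrows at \<open>m\<close> all point towards \<open>m\<close> or all away from it.
\<close>

lemma path_quiver_mutate:
  assumes "path_quiver k c B" and "m < k" and "0 < m \<Longrightarrow> Suc m < k \<Longrightarrow> c (m - 1) = - c m"
  shows "sink_or_source k B m"
    and "path_quiver k (\<lambda>i. if i = m \<or> Suc i = m then - c i else c i) (mutate_quiver m B)"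
proof -
  obtain \<eta> where \<eta>: "\<bar>\<eta>\<bar> = 1"
    and col: "\<And>i. i < k \<Longrightarrow> B i m = (if Suc i = m \<or> i = Suc m then \<eta> else 0)"
    using path_quiver_column[OF assms] by blast
  show "sink_or_source k B m"
  proof (cases "\<eta> \<ge> 0")
    case True
    then show ?thesis using col by (auto simp: sink_or_source_def)
  next
    case False
    then show ?thesis using col by (auto simp: sink_or_source_def)
  qed
  have "B m j = - B j m" if "j < k" for j
    using assms(1,2) that by (auto simp: path_quiver_def)
  then have row: "B m j = (if Suc j = m \<or> j = Suc m then - \<eta> else 0)" if "j < k" for j
    using col that by simp
  have "mutate_quiver m B i j = (if i = m \<or> j = m then - B i j else B i j)" if "i < k" "j < k" for i j
    using col[OF that(1)] row[OF that(2)] by (auto simp: mutate_quiver_def max_def)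
  then show "path_quiver k (\<lambda>i. if i = m \<or> Suc i = m then - c i else c i) (mutate_quiver m B)"
    using assms(1) by (auto simp: path_quiver_def)
qed

text \<open>
  Mutation at a vertex \<open>p\<close> with \<open>c (p - 1) \<noteq> c p\<close> exchanges these two values, so a wrong arrow moves to
  the left. At vertex \<open>0\<close> it is reversed for good.
\<close>

lemma reverse_arrow:
  assumes "(B, x) \<in> sink_source_seeds k B0" and "path_quiver k c B" and "Suc p < k"
    and "c p = -1" and "\<And>i. i < p \<Longrightarrow> c i = 1"
  shows "\<exists>B' x'. (B', x') \<in> sink_source_seeds k B0 \<and> path_quiver k (c(p := 1)) B'"
  using assms
proof (induction p arbitrary: B x c)
  case 0
  let ?c = "\<lambda>i. if i = 0 \<or> Suc i = 0 then - c i else c i"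
  have flip: "?c = c(0 := 1)" using 0 by auto
  have "0 < k" using 0 by simp
  have "sink_or_source k B 0" "path_quiver k ?c (mutate_quiver 0 B)"
    by (rule path_quiver_mutate[OF 0(2) \<open>0 < k\<close>]; simp)+
  then show ?case
    using sink_source_seeds.mutation[OF 0(1) \<open>0 < k\<close>] unfolding flip by blast
next
  case (Suc p)
  let ?m = "Suc p"
  let ?c = "\<lambda>i. if i = ?m \<or> Suc i = ?m then - c i else c i"
  have cp: "c p = 1" using Suc.prems(5) by simp
  have m: "?m < k" using Suc.prems(3) by simp
  have alt: "c (?m - 1) = - c ?m" using cp Suc.prems(4) by simp
  have "sink_or_source k B ?m" and path: "path_quiver k ?c (mutate_quiver ?m B)"
    by (rule path_quiver_mutate[OF Suc.prems(2) m]; rule alt)+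
  then have seed: "(mutate_quiver ?m B, mutate_cluster k ?m B x) \<in> sink_source_seeds k B0"
    using sink_source_seeds.mutation[OF Suc.prems(1) m] by blast
  have "\<exists>B' x'. (B', x') \<in> sink_source_seeds k B0 \<and> path_quiver k (?c(p := 1)) B'"
  proof (rule Suc.IH[OF seed path m])
    show "?c p = -1" using cp by simp
    show "?c i = 1" if "i < p" for i using Suc.prems(5)[of i] that by simp
  qed
  moreover have "?c(p := 1) = c(?m := 1)" using Suc.prems(4) cp by auto
  ultimately show ?case by (simp only:)
qed

lemma linear_seed_exists:
  assumes "orientation_of_A k B0"
  shows "\<exists>B x. (B, x) \<in> sink_source_seeds k B0 \<and> path_quiver k (\<lambda>_. 1) B"
proof -
  have "\<exists>B x c. (B, x) \<in> sink_source_seeds k B0 \<and> path_quiver k c B \<and> (\<forall>i<r. Suc i < k \<longrightarrow> c i = 1)" for r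
  proof (induction r)
    case 0
    then show ?case using sink_source_seeds.initial path_quiver_of_orientation[OF assms] by blast
  next
    case (Suc r)
    then obtain B x c where B: "(B, x) \<in> sink_source_seeds k B0" "path_quiver k c B"
      and c: "\<forall>i<r. Suc i < k \<longrightarrow> c i = 1" by blast
    show ?case
    proof (cases "Suc r < k \<and> c r \<noteq> 1")
      case False
      then have "\<forall>i<Suc r. Suc i < k \<longrightarrow> c i = 1" using c by (auto simp: less_Suc_eq)
      then show ?thesis using B by blast
    next
      case True
      then have "c r = -1" using B(2) by (auto simp: path_quiver_def)
      then obtain B' x' where "(B', x') \<in> sink_source_seeds k B0" "path_quiver k (c(r := 1)) B'"
        using reverse_arrow[OF B, of r] True c by auto
      moreover have "\<forall>i<Suc r. Suc i < k \<longrightarrow> (c(r := 1)) i = 1" using c by (auto simp: less_Suc_eq)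
      ultimately show ?thesis by blast
    qed
  qed
  from this[of k] obtain B x c where B: "(B, x) \<in> sink_source_seeds k B0" "path_quiver k c B"
    and c: "\<forall>i<k. Suc i < k \<longrightarrow> c i = 1" by blast
  have "path_quiver k (\<lambda>_. 1) B" by (rule path_quiver_cong[OF B(2)]) (use c in simp)
  then show ?thesis using B(1) by blast
qed

text \<open>
  Mutating the linear orientation at \<open>0, 1, \<dots>, k - 1\<close> meets a source at every step, since
  the previous step has reversed the arrow into it, and leads back to the linear orientation. When
  vertex \<open>i\<close> is exchanged, its left neighbour is already new and its right neighbour is still old.
\<close>

lemma coxeter_sweep:
  assumes "f \<in> nonzero_friezes k B0" and "(B, x) \<in> sink_source_seeds k B0" and "path_quiver k (\<lambda>_. 1) B"
    and "p \<le> k"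
  shows "\<exists>B' x'. (B', x') \<in> sink_source_seeds k B0 \<and> path_quiver k (\<lambda>i. if Suc i = p then -1 else 1) B' \<and>
    (\<forall>i. p \<le> i \<longrightarrow> x' i = x i) \<and>
    (\<forall>i<p. f (x' i) * f (x i) =
       1 + (if i = 0 then 1 else f (x' (i - 1))) * (if Suc i < k then f (x (Suc i)) else 1))"
  using assms(4)
proof (induction p)
  case 0
  show ?case using assms(2,3) by (intro exI[of _ B] exI[of _ x]) simp
next
  case (Suc p)
  from Suc.IH[OF Suc_leD[OF Suc.prems]] obtain B' x' where seed: "(B', x') \<in> sink_source_seeds k B0"
    and path: "path_quiver k (\<lambda>i. if Suc i = p then -1 else 1) B'"
    and old: "\<forall>i. p \<le> i \<longrightarrow> x' i = x i"
    and new: "\<forall>i<p. f (x' i) * f (x i) =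
       1 + (if i = 0 then 1 else f (x' (i - 1))) * (if Suc i < k then f (x (Suc i)) else 1)"
    by blast
  let ?y = "mutate_cluster k p B' x'"
  have p: "p < k" using Suc.prems by simp
  have alt: "(if Suc (p - 1) = p then -1 else 1) = - (if Suc p = p then -1 else (1::int))" if "0 < p"
    using that by simp
  note mut = path_quiver_mutate[OF path p alt]
  have "(mutate_quiver p B', ?y) \<in> sink_source_seeds k B0"
    using seed p mut(1) by (rule sink_source_seeds.mutation)
  moreover have "path_quiver k (\<lambda>i. if Suc i = Suc p then -1 else 1) (mutate_quiver p B')"
    by (rule path_quiver_cong[OF mut(2)]) auto
  moreover have "\<forall>i. Suc p \<le> i \<longrightarrow> ?y i = x i"
    using old by (simp add: mutate_cluster_other)
  moreover have "f (?y i) * f (x i) =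
       1 + (if i = 0 then 1 else f (?y (i - 1))) * (if Suc i < k then f (x (Suc i)) else 1)"
    if "i < Suc p" for i
  proof (cases "i = p")
    case True
    have "f (?y p) * f (x' p) =
        1 + (if p = 0 then 1 else f (x' (p - 1))) * (if Suc p < k then f (x' (Suc p)) else 1)"
      using frieze_exchange[OF assms(1) sink_source_seeds_seeds[OF seed] p]
        exchange_sum_path[OF path p alt, of "\<lambda>i. f (x' i)"] by (rule trans)
    moreover have "?y (p - 1) = x' (p - 1)" if "p \<noteq> 0"
      using that by (simp add: mutate_cluster_other)
    ultimately show ?thesis using True old by (simp split: if_splits)
  next
    case False
    then have "i < p" using that by simp
    then have "?y i = x' i" "?y (i - 1) = x' (i - 1)" by (simp_all add: mutate_cluster_other)
    then show ?thesis using new \<open>i < p\<close> by simp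
  qed
  ultimately show ?case by blast
qed

text \<open>
  Repeated sweeps produce the rows of a frieze pattern. Every entry is the value of the frieze at a
  cluster variable and thus not zero.
\<close>

lemma linear_seed_frieze_pattern:
  assumes "f \<in> nonzero_friezes k B0" and "(B, x) \<in> sink_source_seeds k B0" and "path_quiver k (\<lambda>_. 1) B"
  shows "\<exists>y. frieze_pattern k y \<and> (\<forall>i<k. y 0 (i + 2) = f (x i))"
proof -
  define row where "row a \<longleftrightarrow> (\<exists>B x. (B, x) \<in> sink_source_seeds k B0 \<and> path_quiver k (\<lambda>_. 1) B \<and>
    a = (\<lambda>i. f (x i)))" for a
  define next_row where "next_row a b \<longleftrightarrow> (\<forall>i<k. b i * a i =
    1 + (if i = 0 then 1 else b (i - 1)) * (if Suc i < k then a (Suc i) else 1))" for a b :: "nat \<Rightarrow> int"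
  have step: "\<exists>b. row b \<and> next_row a b" if "row a" for a
  proof -
    obtain B x where B: "(B, x) \<in> sink_source_seeds k B0" "path_quiver k (\<lambda>_. 1) B" and a: "a = (\<lambda>i. f (x i))"
      using \<open>row a\<close> by (auto simp: row_def)
    obtain B' x' where B': "(B', x') \<in> sink_source_seeds k B0"
      "path_quiver k (\<lambda>i. if Suc i = k then -1 else 1) B'" and nr: "next_row a (\<lambda>i. f (x' i))"
      using coxeter_sweep[OF assms(1) B order.refl] unfolding next_row_def a by blast
    have "path_quiver k (\<lambda>_. 1) B'" using path_quiver_cong[OF B'(2)] by simp
    then show ?thesis using B'(1) nr unfolding row_def by blast
  qed
  have "\<exists>a. \<forall>t. (row (a t) \<and> (t = 0 \<longrightarrow> a t = (\<lambda>i. f (x i)))) \<and> next_row (a t) (a (Suc t))"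
    using assms(2,3) step by (intro dependent_nat_choice) (auto simp: row_def)
  then obtain a where row: "\<And>t. row (a t)" and a0: "a 0 = (\<lambda>i. f (x i))"
    and nr: "\<And>t. next_row (a t) (a (Suc t))" by blast
  define y where "y t d = (if d = 0 then 0 else if d = 1 \<or> d \<ge> k + 2 then 1 else a t (d - 2))" for t d
  have nz: "a t i \<noteq> 0" if "i < k" for t i
    using row[of t] frieze_nonzero[OF assms(1) sink_source_seeds_seeds that] by (auto simp: row_def)
  have "y (Suc t) d * y t d = 1 + y (Suc t) (d - 1) * y t (d + 1) \<and> y t d \<noteq> 0"
    if d: "1 \<le> d" "d \<le> k + 1" for t d
  proof (cases "d = 1")
    case True
    then show ?thesis by (simp add: y_def)
  next
    case False
    then have "\<exists>i. d = i + 2" using d by presburger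
    then obtain i where i: "d = i + 2" by blast
    then have "i < k" using d by simp
    then show ?thesis
      using nr[of t] nz[of i t] by (cases i) (auto simp: i y_def next_row_def)
  qed
  then have "frieze_pattern k y" by (auto simp: frieze_pattern_def y_def)
  moreover have "\<forall>i<k. y 0 (i + 2) = f (x i)" by (simp add: y_def a0)
  ultimately show ?thesis by blast
qed

lemma linear_seed_bound:
  assumes "f \<in> nonzero_friezes k B0" and "(B, x) \<in> sink_source_seeds k B0" and "path_quiver k (\<lambda>_. 1) B"
    and "i < k"
  shows "\<bar>f (x i)\<bar> \<le> 2 ^ (k + 3)"
proof -
  obtain y where "frieze_pattern k y" "\<forall>i<k. y 0 (i + 2) = f (x i)"
    using linear_seed_frieze_pattern[OF assms(1-3)] by blast
  then show ?thesis using frieze_pattern_row_bound[of k y "i + 2"] assms(4) by simp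
qed

lemma linear_seed_sign:
  assumes "f \<in> nonzero_friezes k B0" and "(B, x) \<in> sink_source_seeds k B0" and "path_quiver k (\<lambda>_. 1) B"
  shows "(\<forall>i<k. f (x i) > 0) \<or> odd k \<and> (\<forall>i<k. (-1) ^ Suc i * f (x i) > 0)"
proof -
  obtain y where y: "frieze_pattern k y" and x: "\<And>i. i < k \<Longrightarrow> f (x i) = y 0 (i + 2)"
    using linear_seed_frieze_pattern[OF assms(1-3)] by auto
  show ?thesis
    using frieze_pattern_row_sign[OF y]
  proof (elim disjE conjE)
    assume "\<forall>d. 1 \<le> d \<longrightarrow> d \<le> k + 1 \<longrightarrow> y 0 d > 0"
    then show ?thesis using x by simp
  next
    assume "odd k" and neg: "\<forall>d. 1 \<le> d \<longrightarrow> d \<le> k + 1 \<longrightarrow> (-1) ^ (d + 1) * y 0 d > 0"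
    have "(-1) ^ Suc i * f (x i) > 0" if "i < k" for i
      using neg[rule_format, of "i + 2"] that x[OF that] by simp
    then show ?thesis using \<open>odd k\<close> by blast
  qed
qed

section \<open>Counting friezes\<close>

lemma orientation_skew_symmetric: "orientation_of_A k B \<Longrightarrow> skew_symmetric k B"
  unfolding orientation_of_A_def skew_symmetric_def by blast

lemma graded_parity_cong:
  assumes "graded \<sigma> k e B x" and "\<And>i. i < k \<Longrightarrow> even (e i) \<longleftrightarrow> even (e' i)"
  shows "graded \<sigma> k e' B x"
proof -
  have "even (\<Sum>i<k. B i j * int (e' i))" if "j < k" for j
  proof -
    have "even (\<Sum>i<k. B i j * int (e i) - B i j * int (e' i))"
      using assms(2) by (intro dvd_sum) (auto simp flip: right_diff_distrib)
    moreover have "even (\<Sum>i<k. B i j * int (e i))" using assms(1) that by (simp add: graded_def)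
    ultimately show ?thesis by (simp add: sum_subtractf)
  qed
  moreover have "(-1) ^ e i = ((-1) ^ e' i :: rat_fun)" if "i < k" for i
    using assms(2)[OF that] by (simp add: minus_one_power_iff)
  ultimately show ?thesis using assms(1) by (simp add: graded_def)
qed

text \<open>
  At a sink or a source one exchange monomial is \<open>1\<close>, of degree \<open>0\<close>, so the other one has even degree
  and the exchanged variable keeps its parity. This identifies the signs of \<open>\<sigma>\<close> at the linear seed,
  where they are compared with those of the frieze pattern.
\<close>

lemma sink_source_seeds_graded:
  assumes "sign_automorphism e k \<sigma> initial_variable"
    and "(B, x) \<in> sink_source_seeds k B0" and "skew_symmetric k B0" and "graded \<sigma> k e B0 initial_variable"
  shows "graded \<sigma> k e B x"
  using assms(2)
proof (induction rule: sink_source_seeds.induct)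
  case initial
  then show ?case by (rule assms(4))
next
  case (mutation B x m)
  let ?S = "\<Sum>i<k. nat (B i m) * e i"
  have skew: "skew_symmetric k B"
    using seeds_skew_symmetric[OF sink_source_seeds_seeds[OF mutation.hyps(1)] assms(3)] .
  have "even ?S"
    using mutation.hyps(3) unfolding sink_or_source_def
  proof
    assume "\<forall>i<k. 0 \<le> B i m"
    then have zero: "(\<Sum>i<k. nat (- B i m) * e i) = 0" by simp
    show ?thesis
      unfolding graded_column[OF assms(1) mutation.IH mutation.hyps(2)] zero by simp
  next
    assume "\<forall>i<k. B i m \<le> 0"
    then have "?S = 0" by simp
    then show ?thesis by (simp only: dvd_0_right)
  qed
  then have "even ((e(m := e m + ?S)) i) \<longleftrightarrow> even (e i)" for i by simp
  then show ?case
    by (rule graded_parity_cong[OF graded_mutate[OF assms(1) mutation.IH mutation.hyps(2) skew refl]])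
qed

text \<open>
  Since \<open>k\<close> is odd, an odd vertex is never an end of the path and has two neighbours, both even. An even
  vertex has odd neighbours only.
\<close>

lemma alternating_grading:
  assumes "orientation_of_A k B" and "odd k"
    and "sign_automorphism (\<lambda>i. if even i then 1 else 0) k \<sigma> initial_variable"
  shows "graded \<sigma> k (\<lambda>i. if even i then 1 else 0) B initial_variable"
  unfolding graded_def
proof (intro conjI allI impI)
  let ?e = "\<lambda>i. if even i then 1 else (0::nat)"
  show "\<sigma> (initial_variable i) = (-1) ^ ?e i * initial_variable i" if "i < k" for i
    using assms(3) that unfolding sign_automorphism_def by blast
  fix j assume j: "j < k"
  have B: "\<bar>B i j\<bar> = (if j = Suc i \<or> i = Suc j then 1 else 0)" if "i < k" for i
    using assms(1) that j unfolding orientation_of_A_def by blast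
  show "even (\<Sum>i<k. B i j * int (?e i))"
  proof (cases "even j")
    case True
    have "B i j * int (?e i) = 0" if "i < k" for i
      using B[OF that] True by (auto split: if_splits)
    then have "(\<Sum>i<k. B i j * int (?e i)) = 0"
      by (intro sum.neutral) blast
    then show ?thesis by (simp only: dvd_0_right)
  next
    case False
    then have j1: "0 < j" "Suc j < k" using j assms(2) by (auto simp: odd_pos intro: Suc_lessI)
    have "(\<Sum>i<k. B i j * int (?e i)) = (\<Sum>i\<in>{j - 1, Suc j}. B i j * int (?e i))"
    proof (rule sum.mono_neutral_right)
      show "{j - 1, Suc j} \<subseteq> {..<k}" using j1 by auto
      show "\<forall>i\<in>{..<k} - {j - 1, Suc j}. B i j * int (?e i) = 0"
      proof
        fix i assume i: "i \<in> {..<k} - {j - 1, Suc j}"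
        then have "\<not> (j = Suc i \<or> i = Suc j)" by auto
        then have "B i j = 0" using B[of i] i by simp
        then show "B i j * int (?e i) = 0" by simp
      qed
    qed simp
    also have "\<dots> = B (j - 1) j + B (Suc j) j" using False j1 by simp
    also have "even \<dots>"
    proof -
      have "\<bar>B (j - 1) j\<bar> = 1" "\<bar>B (Suc j) j\<bar> = 1" using B[of "j - 1"] B[of "Suc j"] j1 by auto
      then show ?thesis by presburger
    qed
    finally show ?thesis .
  qed
qed

text \<open>
  A frieze is determined by its values on one seed, and on the linear seed these are bounded.
\<close>

lemma finite_nonzero_friezes:
  assumes "orientation_of_A k B"
  shows "finite (nonzero_friezes k B)"
proof -
  obtain C x where C: "(C, x) \<in> sink_source_seeds k B" "path_quiver k (\<lambda>_. 1) C"
    using linear_seed_exists[OF assms] by blast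
  let ?row = "\<lambda>f. map (\<lambda>i. f (x i)) [0..<k]"
  let ?L = "{l. set l \<subseteq> {- (2 ^ (k + 3)) .. (2 ^ (k + 3) :: int)} \<and> length l = k}"
  have "?row f \<in> ?L" if "f \<in> nonzero_friezes k B" for f
    using linear_seed_bound[OF that C] by (auto simp: abs_le_iff minus_le_iff)
  moreover have "inj_on ?row (nonzero_friezes k B)"
  proof (rule inj_onI)
    fix f g assume fg: "f \<in> nonzero_friezes k B" "g \<in> nonzero_friezes k B" and eq: "?row f = ?row g"
    have "f (x i) = g (x i)" if "i < k" for i using eq that by (simp add: map_eq_conv)
    then show "f = g"
      by (rule frieze_eqI[OF fg orientation_skew_symmetric[OF assms] sink_source_seeds_seeds[OF C(1)]])
  qed
  moreover have "finite ?L" by (rule finite_lists_length_eq) simp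
  ultimately show ?thesis by (metis (no_types, lifting) finite_imageD finite_subset image_subsetI)
qed

theorem theorem1p2:
  fixes k :: nat and B :: quiver
  assumes "k \<ge> 1" and "orientation_of_A k B"
  shows "finite (nonzero_friezes k B) \<and> finite (positive_friezes k B) \<and>
    (odd k \<longrightarrow> card (nonzero_friezes k B) = 2 * card (positive_friezes k B)) \<and>
    (even k \<longrightarrow> card (nonzero_friezes k B) = card (positive_friezes k B))"
proof -
  let ?N = "nonzero_friezes k B" and ?P = "positive_friezes k B"
  have skew: "skew_symmetric k B" using assms(2) by (rule orientation_skew_symmetric)
  obtain C x where C: "(C, x) \<in> sink_source_seeds k B" "path_quiver k (\<lambda>_. 1) C"
    using linear_seed_exists[OF assms(2)] by blast
  note seed = sink_source_seeds_seeds[OF C(1)]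
  have fin: "finite ?N" using assms(2) by (rule finite_nonzero_friezes)
  have sub: "?P \<subseteq> ?N" by (auto simp: positive_friezes_def nonzero_friezes_def)
  have pos: "f \<in> ?P \<longleftrightarrow> (\<forall>i<k. f (x i) > 0)" if "f \<in> ?N" for f
    using positive_frieze_iff[OF that skew seed] .
  have "?N = ?P" if "even k"
    using linear_seed_sign[OF _ C] that pos sub by blast
  moreover have "card ?N = 2 * card ?P" if "odd k"
  proof -
    let ?e = "\<lambda>i. if even i then 1 else (0::nat)"
    obtain \<sigma> where \<sigma>: "sign_automorphism ?e k \<sigma> initial_variable"
      using sign_automorphism_exists by blast
    have gr: "graded \<sigma> k ?e B initial_variable"
      using assms(2) that \<sigma> by (rule alternating_grading)
    let ?T = "twist_frieze \<sigma> k B"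
    have T_nz: "?T f \<in> ?N" and T_T: "?T (?T f) = f" if "f \<in> ?N" for f
      using twist_frieze_nonzero[OF \<sigma> that skew gr] twist_frieze_twist_frieze[OF \<sigma> that skew gr] .
    have T_x: "?T f (x i) = (-1) ^ Suc i * f (x i)" if "f \<in> ?N" "i < k" for f i
      using twist_frieze_seed[OF \<sigma> that(1) seed sink_source_seeds_graded[OF \<sigma> C(1) skew gr] that(2)]
      by (simp add: minus_one_power_iff)
    have inj: "inj_on ?T ?P" using T_T sub by (intro inj_on_inverseI[of _ ?T]) blast
    have "?T f \<notin> ?P" if "f \<in> ?P" for f
    proof -
      have "f \<in> ?N" using that sub by blast
      then have "?T f (x 0) = - f (x 0)" "f (x 0) > 0"
        using T_x[of f 0] pos[of f] that assms(1) by auto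
      then show ?thesis using pos[OF T_nz[OF \<open>f \<in> ?N\<close>]] assms(1) by force
    qed
    then have disj: "?P \<inter> ?T ` ?P = {}" by blast
    have "f \<in> ?P \<union> ?T ` ?P" if f: "f \<in> ?N" for f
      using linear_seed_sign[OF f C]
    proof (elim disjE conjE)
      assume "\<forall>i<k. f (x i) > 0"
      then show ?thesis using pos[OF f] by blast
    next
      assume "\<forall>i<k. (-1) ^ Suc i * f (x i) > 0"
      then have "\<forall>i<k. ?T f (x i) > 0" using T_x[OF f] by simp
      then have "?T f \<in> ?P" using pos[OF T_nz[OF f]] by blast
      then show ?thesis using T_T[OF f] by (metis UnI2 imageI)
    qed
    then have "?N = ?P \<union> ?T ` ?P" using sub T_nz by blast
    then show ?thesis
      using card_Un_disjoint[OF _ _ disj] card_image[OF inj] finite_subset[OF sub fin] by simp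
  qed
  ultimately show ?thesis using fin finite_subset[OF sub fin] by auto
qed

end
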